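(* Let $\varphi\in\mathcal{AC}$ satisfy, for each $i\in\mathcal{S}$: (Z2) $\varphi(t,i)\le g(t,i)$ for all $t\in[0,T]$; (Z4) at every $t\in[0,T]$ where $\varphi(\cdot,i)$ is differentiable, $\frac{d}{dt}\varphi(t,i)\ge -H_i(t,\varphi(t))$. Let $\tilde v_\varphi\in\mathcal{V}_{\mathrm{fb}}$ be a feedback strategy of the second player such that, for all $t\in[0,T]$, $i\in\mathcal{S}$, $$\tilde v_\varphi(t,i)\in\operatorname*{Argmax}_{v\in V}\ \min_{u\in U}\Bigl[\sum_{j\in\mathcal{S}}Q_{i,j}(t,u,v)\varphi(t,j)+h(t,i,u,v)\Bigr].$$ Then, for every $t_0\in[0,T]$, $i_0\in\mathcal{S}$, $\alpha\in\mathcal{U}_{t_0}$ and $\tau\in\mathcal{T}_{t_0}$, $$\mathbb{E}^{\alpha,\tilde v_\varphi}_{t_0,i_0}G^{\alpha,\tilde v_\varphi}_{t_0}(\tau)\ge\varphi(t_0,i_0).$$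
   Context: **Data and standing assumptions.** $T>0$; $\mathcal{S}=\{1,\dots,d\}$; $U,V$ are the control spaces of the first and second player; for $(t,u,v)\in[0,T]\times U\times V$, $Q(t,u,v)=(Q_{i,j}(t,u,v))_{i,j=1}^d$ is a Kolmogorov matrix, i.e. $Q_{i,j}(t,u,v)\ge 0$ for $i\ne j$ and $\sum_{j\in\mathcal{S}}Q_{i,j}(t,u,v)=0$; $g:[0,T]\times\mathcal{S}\to\mathbb{R}$ and $h:[0,T]\times\mathcal{S}\times U\times V\to\mathbb{R}$. It is assumed that: (1) $U$ and $V$ are compact; (2) $Q_{i,j}$, $g(\cdot,i)$ and $h(\cdot,i,\cdot,\cdot)$ are continuous for all $i,j$; (3) $g$ is Lipschitz continuous in the time variable; (4) for all $t\in[0,T]$, $i\in\mathcal{S}$, $w\in\mathbb{R}^d$, $$\min_{u\in U}\max_{v\in V}\Bigl[\sum_{j\in\mathcal{S}}Q_{i,j}(t,u,v)w_j+h(t,i,u,v)\Bigr]=\max_{v\in V}\min_{u\in U}\Bigl[\sum_{j\in\mathcal{S}}Q_{i,j}(t,u,v)w_j+h(t,i,u,v)\Bigr].$$ The common value is denoted $H_i(t,w)$. **Path space.** For $t_0\in[0,T]$, $\Omega_{t_0}=D([t_0,T],\mathcal{S})$ is the space of càdlàg functions from $[t_0,T]$ to $\mathcal{S}$, with Borel $\sigma$-algebra $\mathcal{F}_{t_0}$. For $t\in[t_0,T]$, $\mathcal{F}_{t_0,t}$ is the $\sigma$-algebra of all sets $\{\omega\in\Omega_{t_0}:\omega|_{[t_0,t]}\in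 B\}$ with $B$ Borel in $D([t_0,t],\mathcal{S})$, and $\mathbb{F}_{t_0}=\{\mathcal{F}_{t_0,t}\}_{t\in[t_0,T]}$. $\mathcal{T}_{t_0}$ is the set of stopping times w.r.t. $\mathbb{F}_{t_0}$ with values in $[t_0,T]$. **Function class.** $\mathcal{AC}$ is the set of functions $\phi:[0,T]\times\mathcal{S}\to\mathbb{R}$ such that $t\mapsto\phi(t,i)$ is absolutely continuous for each $i$; $\phi(t)$ denotes the vector $(\phi(t,1),\dots,\phi(t,d))^T$. $\frac{\partial}{\partial t}\phi(s,\omega(s))$ denotes the time derivative of $\phi(\cdot,i)$ at $s$ with $i=\omega(s)$. **Strategies.** $\mathcal{V}_{\mathrm{fb}}$ is the set of feedback strategies of the second player: maps $[0,T]\times\mathcal{S}\to V$ measurable in time. $\mathcal{U}_{t_0}$ (resp. $\mathcal{V}_{t_0}$) is the set of strategies with memory of the first (resp. second) player: $\mathbb{F}_{t_0}$-progressively measurable processes on $[t_0,T]\times\Omega_{t_0}$ with values in $U$ (resp. $V$). A feedback strategy $v$ is identified with the strategy with memory $(t,\omega)\mapsto v(t,\omega(t))$. **Probability and payoff.** For $\alpha\in\mathcal{U}_{t_0}$, $\beta\in\mathcal{V}_{t_0}$, $i_0\in\mathcal{S}$, $\mathbb{P}^{\alpha,\beta}_{t_0,i_0}$ is the probability on $\mathcal{F}_{t_0}$ generated by $\alpha,\beta,t_0,i_0$, i.e. such that $\mathbb{P}^{\alpha,\beta}_{t_0,i_0}(\omega(t_0)=i_0)=1$ and, for every $\phi\in\mathcal{AC}$,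 the process $$\phi(t,\omega(t))-\int_{t_0}^t\Bigl[\tfrac{\partial}{\partial t}\phi(t',\omega(t'))+\sum_{j\in\mathcal{S}}Q_{\omega(t'),j}(t',\alpha(t',\omega),\beta(t',\omega))\phi(t',j)\Bigr]dt'$$ is a $(\mathbb{P}^{\alpha,\beta}_{t_0,i_0},\mathbb{F}_{t_0})$-martingale. $\mathbb{E}^{\alpha,\beta}_{t_0,i_0}$ is the corresponding expectation. Put $G^{\alpha,\beta}_{t_0}(t,\omega)=g(t,\omega(t))+\int_{t_0}^t h(t',\omega(t'),\alpha(t',\omega),\beta(t',\omega))\,dt'$; for a stopping time $\tau$, $G^{\alpha,\beta}_{t_0}(\tau)$ denotes $\omega\mapsto G^{\alpha,\beta}_{t_0}(\tau(\omega),\omega)$. *)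

theory Defs
  imports "HOL-Probability.Probability"
begin

section \<open>Path space\<close>

text \<open>
  The state space \<open>{1, \<dots>, d}\<close> is a type \<open>'s\<close> of class \<open>finite\<close> carrying the discrete topology.
  Paths on \<open>[a, b]\<close> are encoded as functions on the whole line that are \<open>extensional\<close> on
  \<open>{a..b}\<close>, so that equality of encodings is equality of paths.
\<close>

definition cadlag_paths :: "real \<Rightarrow> real \<Rightarrow> (real \<Rightarrow> 's) set"
where
  "cadlag_paths a b =
    {\<omega> \<in> extensional {a..b}.
      (\<forall>t\<in>{a..<b}. limitin (discrete_topology UNIV) \<omega> (\<omega> t) (at_right t)) \<and>
      (\<forall>t\<in>{a<..b}. \<exists>l. limitin (discrete_topology UNIV) \<omega> l (at_left t))}"

text \<open>Increasing homeomorphisms of \<open>[a, b]\<close> onto itself (continuity is automatic).\<close>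

definition time_changes :: "real \<Rightarrow> real \<Rightarrow> (real \<Rightarrow> real) set"
where
  "time_changes a b = {l. strict_mono_on {a..b} l \<and> l ` {a..b} = {a..b}}"

text \<open>The Skorokhod (\<open>J\<^sub>1\<close>) metric, with the discrete metric on the state space.\<close>

definition skorokhod_dist :: "real \<Rightarrow> real \<Rightarrow> (real \<Rightarrow> 's) \<Rightarrow> (real \<Rightarrow> 's) \<Rightarrow> real"
where
  "skorokhod_dist a b x y =
    Inf {e. 0 \<le> e \<and> (\<exists>l\<in>time_changes a b. \<forall>t\<in>{a..b}.
              \<bar>l t - t\<bar> \<le> e \<and> of_bool (x t \<noteq> y (l t)) \<le> e)}"

definition path_borel :: "real \<Rightarrow> real \<Rightarrow> (real \<Rightarrow> 's) measure"
where
  "path_borel a b =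
    sigma (cadlag_paths a b)
      {A. openin (Metric_space.mtopology (cadlag_paths a b) (skorokhod_dist a b)) A}"

text \<open>
  \<open>path_filtration T t0 t\<close> is the \<open>\<sigma>\<close>-algebra generated by the restriction of paths to \<open>[t0, t]\<close>.
  Since the library indexes filtrations by a whole type, the index is capped at \<open>T\<close>; for
  \<open>t < t0\<close> the \<open>\<sigma>\<close>-algebra is trivial.
\<close>

definition path_filtration :: "real \<Rightarrow> real \<Rightarrow> real \<Rightarrow> (real \<Rightarrow> 's) measure"
where
  "path_filtration T t0 t =
    vimage_algebra (cadlag_paths t0 T) (\<lambda>\<omega>. restrict \<omega> {t0..min t T}) (path_borel t0 (min t T))"

definition stopping_times :: "real \<Rightarrow> real \<Rightarrow> ((real \<Rightarrow> 's) \<Rightarrow> real) set"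
where
  "stopping_times T t0 =
    {\<tau> \<in> cadlag_paths t0 T \<rightarrow> {t0..T}. stopping_time (path_filtration T t0) \<tau>}"

lemma time_changes_id: "(\<lambda>t. t) \<in> time_changes a b"
  by (auto simp: time_changes_def strict_mono_on_def)

lemma time_changes_compose:
  assumes "k \<in> time_changes a b" "l \<in> time_changes a b"
  shows "(\<lambda>t. l (k t)) \<in> time_changes a b"
proof -
  have k: "strict_mono_on {a..b} k" "k ` {a..b} = {a..b}"
    and l: "strict_mono_on {a..b} l" "l ` {a..b} = {a..b}"
    using assms by (auto simp: time_changes_def)
  have "k t \<in> {a..b}" if "t \<in> {a..b}" for t
    using k(2) that by blast
  then have "strict_mono_on {a..b} (\<lambda>t. l (k t))"
    using k(1) l(1) unfolding strict_mono_on_def by blast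
  moreover have "(\<lambda>t. l (k t)) ` {a..b} = {a..b}"
    using k(2) l(2) by (metis image_image)
  ultimately show ?thesis
    by (simp add: time_changes_def)
qed

lemma time_changes_inverse:
  assumes "l \<in> time_changes a b"
  obtains k where "k \<in> time_changes a b" "\<And>t. t \<in> {a..b} \<Longrightarrow> l (k t) = t"
proof
  have l: "strict_mono_on {a..b} l" "l ` {a..b} = {a..b}"
    using assms by (auto simp: time_changes_def)
  have inj: "inj_on l {a..b}"
    using l(1) by (rule strict_mono_on_imp_inj_on)
  let ?k = "inv_into {a..b} l"
  show lk: "l (?k t) = t" if "t \<in> {a..b}" for t
    using that l(2) by (simp add: f_inv_into_f)
  have kin: "?k t \<in> {a..b}" if "t \<in> {a..b}" for t
    using that l(2) inv_into_into by metis
  have "strict_mono_on {a..b} ?k"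
  proof (rule strict_mono_onI)
    fix r s assume rs: "r \<in> {a..b}" "s \<in> {a..b}" "r < s"
    show "?k r < ?k s"
    proof (rule ccontr)
      assume "\<not> ?k r < ?k s"
      then have "l (?k s) \<le> l (?k r)"
        using l(1) kin rs strict_mono_on_leD[of "{a..b}" l "?k s" "?k r"] by auto
      then show False
        using lk rs by auto
    qed
  qed
  moreover have "?k ` {a..b} = {a..b}"
    using l(2) inj by (metis inv_into_image_cancel order_refl)
  ultimately show "?k \<in> time_changes a b"
    by (simp add: time_changes_def)
qed

lemma skorokhod_dist_less_iff:
  "skorokhod_dist a b x y < r \<longleftrightarrow>
    (\<exists>e<r. 0 \<le> e \<and> (\<exists>l\<in>time_changes a b. \<forall>t\<in>{a..b}.
              \<bar>l t - t\<bar> \<le> e \<and> of_bool (x t \<noteq> y (l t)) \<le> e))"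
proof -
  let ?E = "{e. 0 \<le> e \<and> (\<exists>l\<in>time_changes a b. \<forall>t\<in>{a..b}.
              \<bar>l t - t\<bar> \<le> e \<and> of_bool (x t \<noteq> y (l t)) \<le> e)}"
  have "1 \<in> ?E"
    by (auto intro!: bexI[OF _ time_changes_id])
  then have "?E \<noteq> {}"
    by blast
  moreover have "bdd_below ?E"
    by (auto intro: bdd_belowI[of _ 0])
  ultimately show ?thesis
    unfolding skorokhod_dist_def by (subst cInf_less_iff) auto
qed

lemma skorokhod_dist_nonneg: "0 \<le> skorokhod_dist a b x y"
proof (rule ccontr)
  assume "\<not> 0 \<le> skorokhod_dist a b x y"
  then have "skorokhod_dist a b x y < 0"
    by simp
  then obtain e :: real where "e < 0" "0 \<le> e"
    unfolding skorokhod_dist_less_iff by blast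
  then show False
    by simp
qed

lemma skorokhod_dist_commute_le: "skorokhod_dist a b y x \<le> skorokhod_dist a b x y"
proof (rule dense_ge)
  fix r assume "skorokhod_dist a b x y < r"
  then obtain e l where e: "e < r" "0 \<le> e" "l \<in> time_changes a b"
    and l: "\<forall>t\<in>{a..b}. \<bar>l t - t\<bar> \<le> e \<and> of_bool (x t \<noteq> y (l t)) \<le> e"
    unfolding skorokhod_dist_less_iff by blast
  obtain k where k: "k \<in> time_changes a b" "\<And>t. t \<in> {a..b} \<Longrightarrow> l (k t) = t"
    using time_changes_inverse[OF e(3)] by metis
  have "k t \<in> {a..b}" if "t \<in> {a..b}" for t
    using k(1) that unfolding time_changes_def by blast
  then have "\<bar>k t - t\<bar> \<le> e \<and> of_bool (y t \<noteq> x (k t)) \<le> e" if "t \<in> {a..b}" for t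
    using l[rule_format, of "k t"] k(2)[OF that] that by (simp add: abs_minus_commute eq_commute)
  then have "skorokhod_dist a b y x < r"
    unfolding skorokhod_dist_less_iff using e(1,2) k(1) by blast
  then show "skorokhod_dist a b y x \<le> r"
    by simp
qed

lemma skorokhod_dist_triangle:
  "skorokhod_dist a b x z \<le> skorokhod_dist a b x y + skorokhod_dist a b y z"
proof (rule dense_ge)
  fix r assume r: "skorokhod_dist a b x y + skorokhod_dist a b y z < r"
  define d where "d = (r - skorokhod_dist a b x y - skorokhod_dist a b y z) / 2"
  have d: "d > 0"
    using r by (simp add: d_def)
  then have "skorokhod_dist a b x y < skorokhod_dist a b x y + d"
    and "skorokhod_dist a b y z < skorokhod_dist a b y z + d"
    by auto
  then obtain e f k l where
      e: "e < skorokhod_dist a b x y + d" "0 \<le> e" "k \<in> time_changes a b"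
        "\<forall>t\<in>{a..b}. \<bar>k t - t\<bar> \<le> e \<and> of_bool (x t \<noteq> y (k t)) \<le> e"
    and f: "f < skorokhod_dist a b y z + d" "0 \<le> f" "l \<in> time_changes a b"
        "\<forall>t\<in>{a..b}. \<bar>l t - t\<bar> \<le> f \<and> of_bool (y t \<noteq> z (l t)) \<le> f"
    unfolding skorokhod_dist_less_iff by blast
  have "\<bar>l (k t) - t\<bar> \<le> e + f \<and> of_bool (x t \<noteq> z (l (k t))) \<le> e + f" if t: "t \<in> {a..b}" for t
  proof -
    have kt: "k t \<in> {a..b}"
      using e(3) t unfolding time_changes_def by blast
    show ?thesis
      using e(2) e(4)[rule_format, OF t] f(2) f(4)[rule_format, OF kt]
      by (cases "x t = y (k t)"; cases "y (k t) = z (l (k t))") (auto simp: of_bool_def)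
  qed
  moreover have "e + f < r"
    using e(1) f(1) by (simp add: d_def field_simps)
  ultimately have "skorokhod_dist a b x z < r"
    unfolding skorokhod_dist_less_iff using e(2) f(2)
    by (intro exI[of _ "e + f"] conjI bexI[OF _ time_changes_compose[OF e(3) f(3)]] ballI)
      (simp_all only: add_nonneg_nonneg)
  then show "skorokhod_dist a b x z \<le> r"
    by simp
qed

lemma cadlag_pathsD_right:
  assumes "x \<in> cadlag_paths a b" "t \<in> {a..<b}"
  obtains d where "0 < d" "t + d \<le> b" "\<And>s. t \<le> s \<Longrightarrow> s < t + d \<Longrightarrow> x s = x t"
proof -
  have "limitin (discrete_topology UNIV) x (x t) (at_right t)"
    using assms by (auto simp: cadlag_paths_def)
  then have "eventually (\<lambda>s. x s \<in> {x t}) (at_right t)"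
    by (rule limitinD) auto
  then obtain c where c: "t < c" "\<And>s. t < s \<Longrightarrow> s < c \<Longrightarrow> x s = x t"
    unfolding eventually_at_right_field by auto
  show thesis
  proof (rule that[of "min c b - t"])
    fix s assume "t \<le> s" "s < t + (min c b - t)"
    then show "x s = x t"
      using c(2)[of s] by (cases "s = t") auto
  qed (use c(1) assms(2) in auto)
qed

lemma time_changes_right_end:
  assumes "l \<in> time_changes a b" "a \<le> b"
  shows "l b = b"
proof -
  have l: "strict_mono_on {a..b} l" "l ` {a..b} = {a..b}"
    using assms by (auto simp: time_changes_def)
  obtain t where t: "t \<in> {a..b}" "l t = b"
    using l(2) assms(2) by (metis atLeastAtMost_iff imageE order_refl)
  then have "b \<le> l b"
    using strict_mono_on_leD[OF l(1), of t b] assms(2) by auto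
  moreover have "l b \<le> b"
    using l(2) assms(2) by (metis atLeastAtMost_iff image_eqI order_refl)
  ultimately show ?thesis
    by simp
qed

lemma skorokhod_dist_eq_0D:
  assumes x: "x \<in> cadlag_paths a b" and y: "y \<in> cadlag_paths a b"
    and 0: "skorokhod_dist a b x y = 0"
  shows "x = y"
proof (rule extensionalityI)
  show "x \<in> extensional {a..b}" "y \<in> extensional {a..b}"
    using x y by (auto simp: cadlag_paths_def)
  fix t assume t: "t \<in> {a..b}"
  have match: "\<exists>l\<in>time_changes a b. \<forall>t\<in>{a..b}. \<bar>l t - t\<bar> < r \<and> x t = y (l t)"
    if r: "0 < r" "r \<le> 1" for r
  proof -
    have "skorokhod_dist a b x y < r"
      using 0 r by simp
    then obtain e l where el: "e < r" "0 \<le> e" "l \<in> time_changes a b"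
      "\<forall>t\<in>{a..b}. \<bar>l t - t\<bar> \<le> e \<and> of_bool (x t \<noteq> y (l t)) \<le> e"
      unfolding skorokhod_dist_less_iff by blast
    have "\<bar>l t - t\<bar> < r \<and> x t = y (l t)" if t: "t \<in> {a..b}" for t
    proof -
      have le: "\<bar>l t - t\<bar> \<le> e" "of_bool (x t \<noteq> y (l t)) \<le> e"
        using el(4) t by blast+
      have "x t = y (l t)"
      proof (rule ccontr)
        assume "x t \<noteq> y (l t)"
        then show False
          using le(2) el(1) r by simp
      qed
      then show ?thesis
        using le(1) el(1) by simp
    qed
    then show ?thesis
      using el(3) by blast
  qed
  show "x t = y t"
  proof (cases "t = b")
    case True
    obtain l where l: "l \<in> time_changes a b" "\<forall>t\<in>{a..b}. \<bar>l t - t\<bar> < 1 \<and> x t = y (l t)"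
      using match[of 1] by auto
    then show ?thesis
      using time_changes_right_end[OF l(1)] True t by auto
  next
    case False
    then have tb: "t \<in> {a..<b}"
      using t by auto
    obtain c where c: "0 < c" "t + c \<le> b" "\<And>s. t \<le> s \<Longrightarrow> s < t + c \<Longrightarrow> x s = x t"
      using cadlag_pathsD_right[OF x tb] by metis
    obtain d where d: "0 < d" "t + d \<le> b" "\<And>s. t \<le> s \<Longrightarrow> s < t + d \<Longrightarrow> y s = y t"
      using cadlag_pathsD_right[OF y tb] by metis
    define m where "m = min c d / 2"
    have m: "0 < m" "m < c" "m < d" "2 * m \<le> d"
      using c(1) d(1) by (auto simp: m_def)
    obtain l where l: "\<forall>t\<in>{a..b}. \<bar>l t - t\<bar> < min m 1 \<and> x t = y (l t)"
      using match[of "min m 1"] m by auto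
    have s: "t + m \<in> {a..b}"
      using m c t by auto
    then have near: "\<bar>l (t + m) - (t + m)\<bar> < m" and eq: "x (t + m) = y (l (t + m))"
      using l[rule_format, of "t + m"] by simp_all
    have "x (t + m) = x t"
      using m by (intro c(3)) simp_all
    moreover have "y (l (t + m)) = y t"
    proof (rule d(3))
      show "t \<le> l (t + m)" "l (t + m) < t + d"
        using near m by linarith+
    qed
    ultimately show ?thesis
      using eq by simp
  qed
qed

lemma Metric_space_skorokhod: "Metric_space (cadlag_paths a b) (skorokhod_dist a b)"
proof
  fix x y z :: "real \<Rightarrow> 's"
  show "0 \<le> skorokhod_dist a b x y"
    by (rule skorokhod_dist_nonneg)
  show "skorokhod_dist a b x y = skorokhod_dist a b y x"
    by (intro antisym skorokhod_dist_commute_le)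
  show "skorokhod_dist a b x z \<le> skorokhod_dist a b x y + skorokhod_dist a b y z"
    by (rule skorokhod_dist_triangle)
  assume xy: "x \<in> cadlag_paths a b" "y \<in> cadlag_paths a b"
  have "skorokhod_dist a b x x < r" if "0 < r" for r
    unfolding skorokhod_dist_less_iff
    by (rule exI[of _ 0], intro conjI, rule that, simp, rule bexI[OF _ time_changes_id], simp)
  then have "skorokhod_dist a b x x = 0"
    using skorokhod_dist_nonneg[of a b x x] by (metis less_irrefl order_le_less)
  then show "skorokhod_dist a b x y = 0 \<longleftrightarrow> x = y"
    using skorokhod_dist_eq_0D[OF xy] by blast
qed


section \<open>The game\<close>

definition Kolmogorov_matrix :: "('s::finite \<Rightarrow> 's \<Rightarrow> real) \<Rightarrow> bool"
where
  "Kolmogorov_matrix A \<longleftrightarrow> (\<forall>i j. i \<noteq> j \<longrightarrow> 0 \<le> A i j) \<and> (\<forall>i. (\<Sum>j\<in>UNIV. A i j) = 0)"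

definition pre_Hamiltonian ::
  "(real \<Rightarrow> 'u \<Rightarrow> 'v \<Rightarrow> 's::finite \<Rightarrow> 's \<Rightarrow> real) \<Rightarrow> (real \<Rightarrow> 's \<Rightarrow> 'u \<Rightarrow> 'v \<Rightarrow> real) \<Rightarrow>
    's \<Rightarrow> real \<Rightarrow> ('s \<Rightarrow> real) \<Rightarrow> 'u \<Rightarrow> 'v \<Rightarrow> real"
where
  "pre_Hamiltonian Q h i t w u v = (\<Sum>j\<in>UNIV. Q t u v i j * w j) + h t i u v"

text \<open>
  Minima and maxima over the compact control sets are written as infima and suprema; they are
  attained because \<open>Q\<close> and \<open>h\<close> are continuous.
\<close>

definition Hamiltonian ::
  "'u set \<Rightarrow> 'v set \<Rightarrow> (real \<Rightarrow> 'u \<Rightarrow> 'v \<Rightarrow> 's::finite \<Rightarrow> 's \<Rightarrow> real) \<Rightarrow>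
    (real \<Rightarrow> 's \<Rightarrow> 'u \<Rightarrow> 'v \<Rightarrow> real) \<Rightarrow> 's \<Rightarrow> real \<Rightarrow> ('s \<Rightarrow> real) \<Rightarrow> real"
where
  "Hamiltonian U V Q h i t w = (INF u\<in>U. SUP v\<in>V. pre_Hamiltonian Q h i t w u v)"

definition abs_continuous_on :: "real \<Rightarrow> real \<Rightarrow> (real \<Rightarrow> real) \<Rightarrow> bool"
where
  "abs_continuous_on a b f \<longleftrightarrow>
    (\<forall>e>0. \<exists>d>0. \<forall>n::nat. \<forall>p q :: nat \<Rightarrow> real.
      (\<forall>k<n. a \<le> p k \<and> p k \<le> q k \<and> q k \<le> b) \<and>
      disjoint_family_on (\<lambda>k. {p k<..<q k}) {..<n} \<and>
      (\<Sum>k<n. q k - p k) < d \<longrightarrow>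
      (\<Sum>k<n. \<bar>f (q k) - f (p k)\<bar>) < e)"

definition AC :: "real \<Rightarrow> (real \<Rightarrow> 's \<Rightarrow> real) set"
where
  "AC T = {\<phi>. \<forall>i. abs_continuous_on 0 T (\<lambda>t. \<phi> t i)}"

text \<open>
  Functions of time live on \<open>[0, T]\<close>, so derivatives are taken within \<open>{0..T}\<close>. At the
  (Lebesgue-null) set of points of non-differentiability the value below is arbitrary.
\<close>

definition time_derivative :: "real \<Rightarrow> (real \<Rightarrow> 's \<Rightarrow> real) \<Rightarrow> real \<Rightarrow> 's \<Rightarrow> real"
where
  "time_derivative T \<phi> s i = vector_derivative (\<lambda>t. \<phi> t i) (at s within {0..T})"

definition feedback_strategies :: "real \<Rightarrow> 'c::topological_space set \<Rightarrow> (real \<Rightarrow> 's \<Rightarrow> 'c) set"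
where
  "feedback_strategies T C =
    {c. \<forall>i. (\<lambda>t. c t i) \<in> restrict_space borel {0..T} \<rightarrow>\<^sub>M restrict_space borel C}"

text \<open>Progressively measurable processes with values in \<open>C\<close>.\<close>

definition memory_strategies ::
  "real \<Rightarrow> real \<Rightarrow> 'c::topological_space set \<Rightarrow> (real \<Rightarrow> (real \<Rightarrow> 's) \<Rightarrow> 'c) set"
where
  "memory_strategies T t0 C =
    {\<gamma>. \<forall>t\<in>{t0..T}. (\<lambda>(s, \<omega>). \<gamma> s \<omega>) \<in>
      restrict_space borel {t0..t} \<Otimes>\<^sub>M path_filtration T t0 t \<rightarrow>\<^sub>M restrict_space borel C}"

definition feedback_to_memory :: "(real \<Rightarrow> 's \<Rightarrow> 'c) \<Rightarrow> real \<Rightarrow> (real \<Rightarrow> 's) \<Rightarrow> 'c"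
where
  "feedback_to_memory c = (\<lambda>t \<omega>. c t (\<omega> t))"

definition martingale_on ::
  "'a measure \<Rightarrow> (real \<Rightarrow> 'a measure) \<Rightarrow> real set \<Rightarrow> (real \<Rightarrow> 'a \<Rightarrow> real) \<Rightarrow> bool"
where
  "martingale_on M F I X \<longleftrightarrow>
    filtration (space M) F \<and> (\<forall>t. subalgebra M (F t)) \<and>
    (\<forall>t\<in>I. X t \<in> borel_measurable (F t) \<and> integrable M (X t)) \<and>
    (\<forall>s\<in>I. \<forall>t\<in>I. s \<le> t \<longrightarrow> (AE \<omega> in M. real_cond_exp M (F s) (X t) \<omega> = X s \<omega>))"

definition Dynkin_process ::
  "real \<Rightarrow> (real \<Rightarrow> 'u \<Rightarrow> 'v \<Rightarrow> 's::finite \<Rightarrow> 's \<Rightarrow> real) \<Rightarrow> real \<Rightarrow>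
    (real \<Rightarrow> (real \<Rightarrow> 's) \<Rightarrow> 'u) \<Rightarrow> (real \<Rightarrow> (real \<Rightarrow> 's) \<Rightarrow> 'v) \<Rightarrow>
    (real \<Rightarrow> 's \<Rightarrow> real) \<Rightarrow> real \<Rightarrow> (real \<Rightarrow> 's) \<Rightarrow> real"
where
  "Dynkin_process T Q t0 \<alpha> \<beta> \<phi> t \<omega> =
    \<phi> t (\<omega> t) -
    (LINT s:{t0..t}|lebesgue.
      time_derivative T \<phi> s (\<omega> s) + (\<Sum>j\<in>UNIV. Q s (\<alpha> s \<omega>) (\<beta> s \<omega>) (\<omega> s) j * \<phi> s j))"

definition generated_probability ::
  "real \<Rightarrow> (real \<Rightarrow> 'u \<Rightarrow> 'v \<Rightarrow> 's::finite \<Rightarrow> 's \<Rightarrow> real) \<Rightarrow> real \<Rightarrow> 's \<Rightarrow>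
    (real \<Rightarrow> (real \<Rightarrow> 's) \<Rightarrow> 'u) \<Rightarrow> (real \<Rightarrow> (real \<Rightarrow> 's) \<Rightarrow> 'v) \<Rightarrow>
    (real \<Rightarrow> 's) measure \<Rightarrow> bool"
where
  "generated_probability T Q t0 i0 \<alpha> \<beta> P \<longleftrightarrow>
    prob_space P \<and> sets P = sets (path_borel t0 T) \<and>
    measure P {\<omega> \<in> space P. \<omega> t0 = i0} = 1 \<and>
    (\<forall>\<phi>\<in>AC T. martingale_on P (path_filtration T t0) {t0..T} (Dynkin_process T Q t0 \<alpha> \<beta> \<phi>))"

definition payoff ::
  "(real \<Rightarrow> 's \<Rightarrow> real) \<Rightarrow> (real \<Rightarrow> 's \<Rightarrow> 'u \<Rightarrow> 'v \<Rightarrow> real) \<Rightarrow> real \<Rightarrow>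
    (real \<Rightarrow> (real \<Rightarrow> 's) \<Rightarrow> 'u) \<Rightarrow> (real \<Rightarrow> (real \<Rightarrow> 's) \<Rightarrow> 'v) \<Rightarrow>
    real \<Rightarrow> (real \<Rightarrow> 's) \<Rightarrow> real"
where
  "payoff g h t0 \<alpha> \<beta> t \<omega> =
    g t (\<omega> t) + (LINT s:{t0..t}|lebesgue. h s (\<omega> s) (\<alpha> s \<omega>) (\<beta> s \<omega>))"

end

theory Submission
  imports Defs
begin

text \<open>
  Along the feedback \<open>v\<phi>\<close> the process \<open>\<phi> t (\<omega> t) + \<integral>h\<close> is a submartingale, and the payoff lies
  above it. Write \<open>M\<close> for the Dynkin martingale of \<open>\<phi>\<close>. Since \<open>v\<phi>\<close> attains the maximin in the
  Hamiltonian, any control \<open>u\<close> of the first player gives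
  \<open>(\<Sum>j. Q i j * \<phi> j) + h \<ge> H i \<ge> - \<phi>'\<close> at almost every time (lemma \<open>SUP_INF_le_arg_max\<close> together
  with the differential inequality). Integrating this along a path and using \<open>\<phi> \<le> g\<close> shows that the
  payoff dominates \<open>M\<close> at every time and on every path, so that optional stopping yields
  \<open>E G(\<tau>) \<ge> E M(\<tau>) = E M(t0) = \<phi> t0 i0\<close>.

  Two points carry the weight. The differential inequality is assumed only where \<open>\<phi>\<close> is
  differentiable, hence it says something only because an absolutely continuous function is
  differentiable almost everywhere (\<open>abs_continuous_on_differentiable_ae\<close>). This is proved with the
  Vitali covering theorem. If \<open>f\<close> had slopes above \<open>q\<close> and slopes below \<open>p < q\<close> at all scales on a
  set \<open>E\<close>, then \<open>E\<close> could be covered up to small measure by finitely many disjoint intervals of slope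
  at least \<open>q\<close>, and inside these by disjoint intervals of slope at most \<open>p\<close>. The two families leave
  only gaps of small total length, over which \<open>f\<close> varies little, so \<open>q\<close> times the outer measure of
  \<open>E\<close> is at most \<open>p\<close> times it, and \<open>E\<close> is null. The derivative must in addition be Lebesgue
  integrable, because otherwise the integral in \<open>M\<close> would be the default value zero: it is Henstock
  integrable by \<open>abs_continuous_on_has_integral\<close>, and it is bounded below by the differential
  inequality.

  The second point is measurability. The control sets are arbitrary compact spaces, whose Borel sets
  need not be compatible with products; \<open>borel_measurable_continuous_compact_box\<close> circumvents this by
  compactness. For paths, evaluation is shown to be Borel for the Skorokhod topology and jointly
  measurable in time and path. The stopping time is approximated from above by finitely valued ones,
  for which optional stopping is a finite sum; only the payoff, which is bounded and right-continuous
  in time, is passed to the limit.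
\<close>

section \<open>Increments of absolutely continuous functions\<close>

lemma abs_continuous_on_family:
  fixes f :: "real \<Rightarrow> real"
  assumes "abs_continuous_on a b f" "0 < e"
  obtains d where "0 < d"
    "\<And>(S :: 'i set) u v. finite S \<Longrightarrow> (\<And>i. i \<in> S \<Longrightarrow> a \<le> u i \<and> u i \<le> v i \<and> v i \<le> b) \<Longrightarrow>
      disjoint_family_on (\<lambda>i. {u i<..<v i}) S \<Longrightarrow> (\<Sum>i\<in>S. v i - u i) < d \<Longrightarrow>
      (\<Sum>i\<in>S. \<bar>f (v i) - f (u i)\<bar>) < e"
proof -
  obtain d where d: "0 < d" and D: "\<And>(n::nat) p q. (\<forall>k<n. a \<le> p k \<and> p k \<le> q k \<and> q k \<le> b) \<and>
      disjoint_family_on (\<lambda>k. {p k<..<q k}) {..<n} \<and> (\<Sum>k<n. q k - p k) < d \<Longrightarrow>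
      (\<Sum>k<n. \<bar>f (q k) - f (p k)\<bar>) < e"
    using assms unfolding abs_continuous_on_def by meson
  show thesis
  proof (rule that[OF d])
    fix S :: "'i set" and u v :: "'i \<Rightarrow> real"
    assume S: "finite S" and uv: "\<And>i. i \<in> S \<Longrightarrow> a \<le> u i \<and> u i \<le> v i \<and> v i \<le> b"
      and disj: "disjoint_family_on (\<lambda>i. {u i<..<v i}) S" and small: "(\<Sum>i\<in>S. v i - u i) < d"
    obtain k where k: "bij_betw k {..<card S} S"
      using ex_bij_betw_nat_finite[OF S] by (auto simp: atLeast0LessThan)
    have inS: "k j \<in> S" if "j < card S" for j
      using k that by (auto simp: bij_betw_def)
    have "disjoint_family_on (\<lambda>j. {u (k j)<..<v (k j)}) {..<card S}"
      unfolding disjoint_family_on_def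
    proof (intro ballI impI)
      fix m n assume mn: "m \<in> {..<card S}" "n \<in> {..<card S}" "m \<noteq> n"
      then have "k m \<noteq> k n"
        using k by (auto simp: bij_betw_def inj_on_def)
      then show "{u (k m)<..<v (k m)} \<inter> {u (k n)<..<v (k n)} = {}"
        using disjoint_family_onD[OF disj inS[of m] inS[of n]] mn by auto
    qed
    moreover have "(\<Sum>j<card S. v (k j) - u (k j)) < d"
      using small by (simp add: sum.reindex_bij_betw[OF k, of "\<lambda>i. v i - u i"])
    ultimately have "(\<Sum>j<card S. \<bar>f (v (k j)) - f (u (k j))\<bar>) < e"
      using uv inS by (intro D) auto
    then show "(\<Sum>i\<in>S. \<bar>f (v i) - f (u i)\<bar>) < e"
      by (simp add: sum.reindex_bij_betw[OF k, of "\<lambda>i. \<bar>f (v i) - f (u i)\<bar>"])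
  qed
qed

lemma division_increment_sum:
  fixes f :: "real \<Rightarrow> real"
  assumes "a \<le> b" "q division_of {a..b}"
  shows "(\<Sum>K\<in>q. f (Sup K) - f (Inf K)) = f b - f a"
proof -
  let ?f = "\<lambda>K::real set. if K = {} then 0 else f (interval_upperbound K) - f (interval_lowerbound K)"
  interpret operative_real plus 0 ?f
    rewrites "comm_monoid_set.F (+) 0 = sum"
    by standard[1] (auto simp add: sum_def)
  have "(\<Sum>K\<in>q. f (Sup K) - f (Inf K)) = sum ?f q"
    using assms(2) by (intro sum.cong refl) (auto simp: division_of_def)
  also have "\<dots> = ?f {a..b}"
    using division[of q a b] assms by simp
  finally show ?thesis
    using assms(1) by simp
qed

text \<open>
  The intervals of \<open>J\<close> lie inside those of \<open>I\<close> and fill them up to a small total length. Extending the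
  members of \<open>J\<close> inside each member of \<open>I\<close> to a division exhibits the difference of the two sums of
  increments as a sum over the remaining gaps, where absolute continuity applies. Taking the same
  difference for the identity function computes the total length of the gaps.
\<close>

lemma abs_continuous_on_gaps:
  fixes f :: "real \<Rightarrow> real"
  assumes ac: "abs_continuous_on a b f" and e: "0 < e"
  obtains d where "0 < d"
    "\<And>I J :: (real \<times> real) set. \<lbrakk>finite I; finite J;
      \<And>u v. (u, v) \<in> I \<Longrightarrow> a \<le> u \<and> u < v \<and> v \<le> b;
      \<And>u v. (u, v) \<in> J \<Longrightarrow> u < v \<and> (\<exists>(u', v')\<in>I. u' \<le> u \<and> v \<le> v');
      disjoint_family_on (\<lambda>(u, v). {u..v}) I; disjoint_family_on (\<lambda>(u, v). {u..v}) J;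
      (\<Sum>(u, v)\<in>I. v - u) - (\<Sum>(u, v)\<in>J. v - u) < d\<rbrakk> \<Longrightarrow>
      \<bar>(\<Sum>(u, v)\<in>I. f v - f u) - (\<Sum>(u, v)\<in>J. f v - f u)\<bar> < e"
proof -
  obtain d where d: "0 < d" and D:
    "\<And>(S :: ((real \<times> real) \<times> real set) set) u v. finite S \<Longrightarrow> (\<And>i. i \<in> S \<Longrightarrow> a \<le> u i \<and> u i \<le> v i \<and> v i \<le> b) \<Longrightarrow>
      disjoint_family_on (\<lambda>i. {u i<..<v i}) S \<Longrightarrow> (\<Sum>i\<in>S. v i - u i) < d \<Longrightarrow>
      (\<Sum>i\<in>S. \<bar>f (v i) - f (u i)\<bar>) < e"
    using abs_continuous_on_family[OF ac e] by blast
  show thesis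
  proof (rule that[OF d])
    fix I J :: "(real \<times> real) set"
    assume fin: "finite I" "finite J"
      and I: "\<And>u v. (u, v) \<in> I \<Longrightarrow> a \<le> u \<and> u < v \<and> v \<le> b"
      and J: "\<And>u v. (u, v) \<in> J \<Longrightarrow> u < v \<and> (\<exists>(u', v')\<in>I. u' \<le> u \<and> v \<le> v')"
      and dI: "disjoint_family_on (\<lambda>(u, v). {u..v}) I"
      and dJ: "disjoint_family_on (\<lambda>(u, v). {u..v}) J"
      and small: "(\<Sum>(u, v)\<in>I. v - u) - (\<Sum>(u, v)\<in>J. v - u) < d"
    define JJ where "JJ x = {y \<in> J. fst x \<le> fst y \<and> snd y \<le> snd x}" for x :: "real \<times> real"
    define pp where "pp x = (\<lambda>(u, v). {u..v::real}) ` JJ x" for x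
    have inj: "inj_on (\<lambda>(u, v). {u..v::real}) J"
    proof (rule inj_onI, clarify)
      fix u v u' v' assume "(u, v) \<in> J" "(u', v') \<in> J" "{u..v} = {u'..v'}"
      then show "u = u' \<and> v = v'"
        using J[of u v] J[of u' v'] by (simp add: Icc_eq_Icc)
    qed
    have finJJ: "finite (JJ x)" for x
      using fin by (simp add: JJ_def)
    have "\<exists>q. pp x \<subseteq> q \<and> q division_of {fst x..snd x}" if "x \<in> I" for x
    proof -
      have "pp x division_of \<Union>(pp x)"
      proof (rule division_ofI)
        show "finite (pp x)"
          by (simp add: pp_def finJJ)
        fix K assume "K \<in> pp x"
        then obtain u v where uv: "(u, v) \<in> J" "K = {u..v}"
          by (auto simp: pp_def JJ_def)
        then show "K \<subseteq> \<Union>(pp x)" "K \<noteq> {}" "\<exists>a b. K = cbox a b"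
          using \<open>K \<in> pp x\<close> J[of u v] by auto
        fix K2 assume "K2 \<in> pp x" "K \<noteq> K2"
        then obtain u' v' where uv': "(u', v') \<in> J" "K2 = {u'..v'}"
          by (auto simp: pp_def JJ_def)
        then have "(u, v) \<noteq> (u', v')"
          using uv \<open>K \<noteq> K2\<close> by auto
        then have "K \<inter> K2 = {}"
          using disjoint_family_onD[OF dJ uv(1) uv'(1)] uv uv' by simp
        then show "interior K \<inter> interior K2 = {}"
          using interior_subset by blast
      qed simp
      then show ?thesis
      proof (rule partial_division_extend_interval)
        show "\<Union>(pp x) \<subseteq> cbox (fst x) (snd x)"
          by (auto simp: pp_def JJ_def)
      qed auto
    qed
    then obtain q where q: "\<And>x. x \<in> I \<Longrightarrow> pp x \<subseteq> q x" "\<And>x. x \<in> I \<Longrightarrow> q x division_of {fst x..snd x}"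
      by metis
    define G where "G = Sigma I (\<lambda>x. q x - pp x)"
    have finq: "finite (q x)" if "x \<in> I" for x
      using q(2)[OF that] by auto
    have finG: "finite G"
      unfolding G_def using fin finq by auto
    have split: "(\<Sum>(x, K)\<in>G. F (Sup K) - F (Inf K)) = (\<Sum>(u, v)\<in>I. F v - F u) - (\<Sum>(u, v)\<in>J. F v - F u)"
      for F :: "real \<Rightarrow> real"
    proof -
      have pps: "(\<Sum>K\<in>pp x. F (Sup K) - F (Inf K)) = (\<Sum>(u, v)\<in>JJ x. F v - F u)" for x
      proof -
        have "(\<Sum>K\<in>pp x. F (Sup K) - F (Inf K)) =
            (\<Sum>y\<in>JJ x. F (Sup (case y of (u, v) \<Rightarrow> {u..v})) - F (Inf (case y of (u, v) \<Rightarrow> {u..v})))"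
          unfolding pp_def by (subst sum.reindex) (auto intro: inj_on_subset[OF inj] simp: JJ_def)
        also have "\<dots> = (\<Sum>(u, v)\<in>JJ x. F v - F u)"
          using J by (intro sum.cong refl) (force simp: JJ_def)
        finally show ?thesis .
      qed
      have dis: "JJ x \<inter> JJ y = {}" if xy: "x \<in> I" "y \<in> I" "x \<noteq> y" for x y
      proof (rule ccontr)
        assume "JJ x \<inter> JJ y \<noteq> {}"
        then obtain u v where uv: "(u, v) \<in> J" "fst x \<le> u" "v \<le> snd x" "fst y \<le> u" "v \<le> snd y"
          by (auto simp: JJ_def)
        then have "u \<in> (case x of (u, v) \<Rightarrow> {u..v}) \<inter> (case y of (u, v) \<Rightarrow> {u..v})"
          using J[of u v] by (auto split: prod.splits)
        then show False
          using disjoint_family_onD[OF dI xy] by auto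
      qed
      have un: "(\<Union>x\<in>I. JJ x) = J"
        using J by (fastforce simp: JJ_def)
      have "(\<Sum>(x, K)\<in>G. F (Sup K) - F (Inf K)) = (\<Sum>x\<in>I. \<Sum>K\<in>q x - pp x. F (Sup K) - F (Inf K))"
        unfolding G_def using fin finq by (subst sum.Sigma) auto
      also have "\<dots> = (\<Sum>x\<in>I. (\<Sum>K\<in>q x. F (Sup K) - F (Inf K)) - (\<Sum>K\<in>pp x. F (Sup K) - F (Inf K)))"
        using finq q(1) by (intro sum.cong refl sum_diff) auto
      also have "\<dots> = (\<Sum>x\<in>I. (F (snd x) - F (fst x)) - (\<Sum>(u, v)\<in>JJ x. F v - F u))"
      proof (intro sum.cong refl)
        fix x assume "x \<in> I"
        then have "fst x \<le> snd x" using I[of "fst x" "snd x"] by simp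
        then show "(\<Sum>K\<in>q x. F (Sup K) - F (Inf K)) - (\<Sum>K\<in>pp x. F (Sup K) - F (Inf K)) =
            (F (snd x) - F (fst x)) - (\<Sum>(u, v)\<in>JJ x. F v - F u)"
          using division_increment_sum[OF _ q(2)[OF \<open>x \<in> I\<close>], of F] pps by simp
      qed
      also have "\<dots> = (\<Sum>(u, v)\<in>I. F v - F u) - (\<Sum>x\<in>I. \<Sum>(u, v)\<in>JJ x. F v - F u)"
        by (simp add: sum_subtractf split_beta)
      also have "(\<Sum>x\<in>I. \<Sum>(u, v)\<in>JJ x. F v - F u) = (\<Sum>(u, v)\<in>J. F v - F u)"
        using fin finJJ dis by (subst un[symmetric], subst sum.UNION_disjoint) auto
      finally show ?thesis .
    qed
    have bd: "K \<noteq> {} \<and> (\<exists>u v. K = {u..v}) \<and> K \<subseteq> {fst x..snd x} \<and> a \<le> fst x \<and> snd x \<le> b"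
      if "(x, K) \<in> G" for x K
      using that q(2)[of x] I[of "fst x" "snd x"] by (auto simp: G_def division_of_def)
    have "(\<Sum>i\<in>G. \<bar>f (Sup (snd i)) - f (Inf (snd i))\<bar>) < e"
    proof (rule D[OF finG])
      fix i assume "i \<in> G"
      then obtain x K where i: "i = (x, K)" "(x, K) \<in> G" by (cases i) auto
      then show "a \<le> Inf (snd i) \<and> Inf (snd i) \<le> Sup (snd i) \<and> Sup (snd i) \<le> b"
        using bd[OF i(2)] by auto
    next
      show "disjoint_family_on (\<lambda>i. {Inf (snd i)<..<Sup (snd i)}) G"
        unfolding disjoint_family_on_def
      proof (intro ballI impI)
        fix i j assume ij: "i \<in> G" "j \<in> G" "i \<noteq> j"
        obtain x K y L where xy: "i = (x, K)" "j = (y, L)" by (cases i, cases j) auto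
        have *: "interior K \<inter> interior L = {}"
        proof (cases "x = y")
          case True
          then have "K \<in> q x" "L \<in> q x" "K \<noteq> L" "x \<in> I"
            using ij xy by (auto simp: G_def)
          then show ?thesis
            using q(2)[of x] by (auto simp: division_of_def)
        next
          case False
          then have "(case x of (u, v) \<Rightarrow> {u..v}) \<inter> (case y of (u, v) \<Rightarrow> {u..v}) = {}"
            using ij xy by (intro disjoint_family_onD[OF dI]) (auto simp: G_def)
          then have "K \<inter> L = {}"
            using bd[of x K] bd[of y L] ij xy by (auto split: prod.splits)
          then show ?thesis
            using interior_subset by blast
        qed
        obtain u v u' v' where "K = {u..v}" "L = {u'..v'}" "K \<noteq> {}" "L \<noteq> {}"
          using bd[of x K] bd[of y L] ij xy by blast
        then show "{Inf (snd i)<..<Sup (snd i)} \<inter> {Inf (snd j)<..<Sup (snd j)} = {}"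
          using * xy by (simp add: interior_atLeastAtMost_real)
      qed
    next
      have "(\<Sum>i\<in>G. Sup (snd i) - Inf (snd i)) = (\<Sum>(u, v)\<in>I. v - u) - (\<Sum>(u, v)\<in>J. v - u)"
        using split[of "\<lambda>x. x"] by (simp add: split_beta)
      then show "(\<Sum>i\<in>G. Sup (snd i) - Inf (snd i)) < d"
        using small by simp
    qed
    from order.strict_trans1[OF sum_abs this] show "\<bar>(\<Sum>(u, v)\<in>I. f v - f u) - (\<Sum>(u, v)\<in>J. f v - f u)\<bar> < e"
      using split[of f] by (simp add: split_beta)
  qed
qed

lemma abs_continuous_on_imp_continuous_on:
  assumes "abs_continuous_on a b f"
  shows "continuous_on {a..b} f"
  unfolding continuous_on_iff
proof (intro ballI allI impI)
  fix x e :: real assume x: "x \<in> {a..b}" and e: "0 < e"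
  obtain d where d: "0 < d" and D:
    "\<And>(S :: unit set) u v. finite S \<Longrightarrow> (\<And>i. i \<in> S \<Longrightarrow> a \<le> u i \<and> u i \<le> v i \<and> v i \<le> b) \<Longrightarrow>
      disjoint_family_on (\<lambda>i. {u i<..<v i}) S \<Longrightarrow> (\<Sum>i\<in>S. v i - u i) < d \<Longrightarrow>
      (\<Sum>i\<in>S. \<bar>f (v i) - f (u i)\<bar>) < e"
    using abs_continuous_on_family[OF assms e] by blast
  show "\<exists>d>0. \<forall>y\<in>{a..b}. dist y x < d \<longrightarrow> dist (f y) (f x) < e"
  proof (intro exI[of _ d] conjI ballI impI d)
    fix y assume y: "y \<in> {a..b}" "dist y x < d"
    have "(\<Sum>i\<in>{()}. \<bar>f (max x y) - f (min x y)\<bar>) < e"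
      by (rule D[where u = "\<lambda>_. min x y" and v = "\<lambda>_. max x y"])
        (use x y in \<open>auto simp: disjoint_family_on_def dist_real_def max_def min_def\<close>)
    then show "dist (f y) (f x) < e"
      by (auto simp: dist_real_def max_def min_def abs_minus_commute split: if_splits)
  qed
qed

lemma abs_continuous_on_uminus:
  "abs_continuous_on a b f \<Longrightarrow> abs_continuous_on a b (\<lambda>x. - f x)"
  unfolding abs_continuous_on_def by (simp add: abs_minus_commute)

section \<open>Differentiability almost everywhere\<close>

lemma lmeasurable_outer_open:
  fixes S :: "real set"
  assumes "S \<in> lmeasurable" "0 < e"
  obtains W where "open W" "S \<subseteq> W" "W \<in> lmeasurable" "measure lebesgue W < measure lebesgue S + e"
proof -
  obtain W where W: "open W" "S \<subseteq> W" "W - S \<in> lmeasurable" "emeasure lebesgue (W - S) < ennreal e"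
    using assms sets_lebesgue_outer_open by (metis fmeasurableD)
  have eq: "W = S \<union> (W - S)"
    using W(2) by auto
  then have lm: "W \<in> lmeasurable"
    using W(3) assms(1) by (metis fmeasurable.Un)
  have "measure lebesgue W \<le> measure lebesgue S + measure lebesgue (W - S)"
    using measure_Un_le[of S lebesgue "W - S"] eq assms(1) W(3) by (metis fmeasurableD)
  moreover have "measure lebesgue (W - S) < e"
    using W(3,4) assms(2) by (metis emeasure_eq_measure2 ennreal_less_iff measure_nonneg)
  ultimately show thesis
    using that W lm by force
qed

lemma disjoint_intervals_length_le:
  fixes u v :: "'i \<Rightarrow> real"
  assumes I: "finite I" "\<And>i. i \<in> I \<Longrightarrow> u i \<le> v i \<and> {u i<..<v i} \<subseteq> W"
    and disj: "disjoint_family_on (\<lambda>i. {u i<..<v i}) I" and W: "W \<in> lmeasurable"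
  shows "(\<Sum>i\<in>I. v i - u i) \<le> measure lebesgue W"
proof -
  have "(\<Sum>i\<in>I. v i - u i) = (\<Sum>i\<in>I. measure lebesgue {u i<..<v i})"
    using I(2) by (intro sum.cong refl) auto
  also have "\<dots> = measure lebesgue (\<Union>i\<in>I. {u i<..<v i})"
    using I disj by (intro measure_finite_Union[symmetric]) auto
  also have "\<dots> \<le> measure lebesgue W"
    using I W by (intro measure_mono_fmeasurable) auto
  finally show ?thesis .
qed

text \<open>
  A finite form of the Vitali covering theorem for intervals: passing to finitely many intervals, and
  from closed intervals to open ones, costs only a set \<open>R\<close> of small measure. Open intervals are what a
  second application of the lemma, inside the first cover, requires.
\<close>

lemma Vitali_finite_interval_cover:
  fixes E W :: "real set"
  assumes W: "open W" "W \<subseteq> {a..b}" "E \<subseteq> W"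
    and P: "\<And>x d. x \<in> E \<Longrightarrow> 0 < d \<Longrightarrow> \<exists>u v. u < v \<and> x \<in> {u..v} \<and> v - u < d \<and> P u v"
    and e: "0 < e"
  obtains I R where "finite I" "\<And>u v. (u, v) \<in> I \<Longrightarrow> u < v \<and> {u..v} \<subseteq> W \<and> P u v"
    "disjoint_family_on (\<lambda>(u, v). {u..v}) I"
    "R \<in> lmeasurable" "measure lebesgue R < e" "E \<subseteq> R \<union> (\<Union>(u, v)\<in>I. {u<..<v})"
proof -
  define K where "K = {(u, v). u < v \<and> {u..v} \<subseteq> W \<and> P u v}"
  define m where "m i = (fst i + snd i) / 2" for i :: "real \<times> real"
  define r where "r i = (snd i - fst i) / 2" for i :: "real \<times> real"
  have cb: "cball (m i) (r i) = {fst i..snd i}" for i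
    by (simp add: cball_eq_atLeastAtMost m_def r_def field_simps)
  obtain C where C: "countable C" "C \<subseteq> K"
    "pairwise (\<lambda>i j. disjnt (cball (m i) (r i)) (cball (m j) (r j))) C"
    "negligible (E - (\<Union>i\<in>C. cball (m i) (r i)))"
  proof (rule Vitali_covering_theorem_cballs)
    show "0 < r i" if "i \<in> K" for i
      using that by (auto simp: K_def r_def)
    fix x d :: real assume x: "x \<in> E" "0 < d"
    then obtain c where c: "0 < c" "ball x c \<subseteq> W"
      using W by (meson open_contains_ball subsetD)
    obtain u v where uv: "u < v" "x \<in> {u..v}" "v - u < min d c" "P u v"
      using P[OF x(1), of "min d c"] x c by auto
    have "{u..v} \<subseteq> ball x c"
      using uv by (auto simp: dist_real_def)
    then have "(u, v) \<in> K"
      using uv c by (auto simp: K_def)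
    then show "\<exists>i. i \<in> K \<and> x \<in> cball (m i) (r i) \<and> r i < d"
      using uv unfolding cb by (intro exI[of _ "(u, v)"]) (auto simp: r_def)
  qed
  define N where "N = E - (\<Union>i\<in>C. {fst i..snd i})"
  have N: "negligible N"
    using C(4) by (simp add: N_def cb)
  have CK: "fst i < snd i" "{fst i..snd i} \<subseteq> W" "P (fst i) (snd i)" if "i \<in> C" for i
    using subsetD[OF C(2) that] by (auto simp: K_def split_beta)
  have Cab: "{fst i..snd i} \<subseteq> {a..b}" if "i \<in> C" for i
    using CK(2)[OF that] W(2) by (rule order_trans)
  have dC: "{fst i..snd i} \<inter> {fst j..snd j} = {}" if "i \<in> C" "j \<in> C" "i \<noteq> j" for i j
    using C(3) that by (auto simp: pairwise_def cb disjnt_def)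
  have "\<exists>F. finite F \<and> F \<subseteq> C \<and> measure lebesgue ((\<Union>i\<in>C. {fst i..snd i}) - (\<Union>i\<in>F. {fst i..snd i})) < e"
  proof (cases "C = {}")
    case True
    then show ?thesis using e by auto
  next
    case False
    define B where "B n = (\<Union>i\<in>C. {fst i..snd i}) - (\<Union>i\<in>from_nat_into C ` {..n}. {fst i..snd i})" for n
    have lmC: "(\<Union>i\<in>C. {fst i..snd i}) \<in> lmeasurable"
      using C(1) Cab by (intro fmeasurable_UN[where A="{a..b}"]) auto
    have lm: "B n \<in> lmeasurable" for n
      unfolding B_def using lmC by (intro fmeasurable_Diff) auto
    have "(\<lambda>n. measure lebesgue (B n)) \<longlonglongrightarrow> measure lebesgue (\<Inter>n. B n)"
    proof (rule Lim_measure_decseq)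
      show "range B \<subseteq> sets lebesgue"
        using lm by (auto dest: fmeasurableD)
      show "emeasure lebesgue (B n) \<noteq> \<infinity>" for n
        using fmeasurableD2[OF lm[of n]] by (simp only: infinity_ennreal_def not_False_eq_True)
      show "decseq B"
        by (rule antimonoI) (fastforce simp: B_def)
    qed
    moreover have "(\<Inter>n. B n) = {}"
    proof -
      have "x \<notin> (\<Inter>n. B n)" for x
      proof
        assume x: "x \<in> (\<Inter>n. B n)"
        then have "x \<in> B 0" by blast
        then obtain i where i: "i \<in> C" "x \<in> {fst i..snd i}"
          by (auto simp: B_def)
        obtain n where "from_nat_into C n = i"
          using i(1) C(1) by (metis from_nat_into_to_nat_on)
        then have "x \<notin> B n"
          using i by (force simp: B_def)
        then show False using x by blast
      qed
      then show ?thesis by blast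
    qed
    ultimately have "(\<lambda>n. measure lebesgue (B n)) \<longlonglongrightarrow> 0"
      by simp
    then have "\<forall>\<^sub>F n in sequentially. measure lebesgue (B n) < e"
      using e by (rule order_tendstoD)
    then obtain n where "measure lebesgue (B n) < e"
      by (auto simp: eventually_sequentially)
    then show ?thesis
      using False by (intro exI[of _ "from_nat_into C ` {..n}"]) (auto simp: B_def intro: from_nat_into)
  qed
  then obtain F where F: "finite F" "F \<subseteq> C"
    "measure lebesgue ((\<Union>i\<in>C. {fst i..snd i}) - (\<Union>i\<in>F. {fst i..snd i})) < e"
    by blast
  define B where "B = (\<Union>i\<in>C. {fst i..snd i}) - (\<Union>i\<in>F. {fst i..snd i})"
  define N' where "N' = N \<union> (fst ` F \<union> snd ` F)"
  have N': "negligible N'"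
    unfolding N'_def using F(1) by (intro negligible_Un[OF N] negligible_finite) auto
  have lmB: "B \<in> lmeasurable"
    unfolding B_def using C(1) Cab by (intro fmeasurable_Diff fmeasurable_UN[where A="{a..b}"]) (auto intro!: sets.finite_UN F(1))
  show thesis
  proof (rule that[of F "B \<union> N'"])
    show "finite F" by fact
    show "u < v \<and> {u..v} \<subseteq> W \<and> P u v" if "(u, v) \<in> F" for u v
      using CK[of "(u, v)"] that F(2) by auto
    show "disjoint_family_on (\<lambda>(u, v). {u..v}) F"
      unfolding disjoint_family_on_def split_beta using dC F(2) by blast
    show "B \<union> N' \<in> lmeasurable"
      using lmB N' by (intro fmeasurable.Un) (auto intro: negligible_imp_measurable)
    have "measure lebesgue (B \<union> N') \<le> measure lebesgue B + measure lebesgue N'"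
      using lmB N' by (intro measure_Un_le) (auto dest: negligible_imp_sets fmeasurableD)
    then show "measure lebesgue (B \<union> N') < e"
      using F(3) N' by (simp add: B_def negligible_imp_measure0)
    show "E \<subseteq> (B \<union> N') \<union> (\<Union>(u, v)\<in>F. {u<..<v})"
    proof
      fix x assume x: "x \<in> E"
      show "x \<in> (B \<union> N') \<union> (\<Union>(u, v)\<in>F. {u<..<v})"
      proof (cases "x \<in> (\<Union>i\<in>F. {fst i..snd i})")
        case True
        then obtain i where i: "i \<in> F" "x \<in> {fst i..snd i}" by blast
        show ?thesis
        proof (cases "x = fst i \<or> x = snd i")
          case True
          then show ?thesis using i by (auto simp: N'_def)
        next
          case False
          then have "x \<in> (case i of (u, v) \<Rightarrow> {u<..<v})"
            using i by (auto simp: split_beta)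
          then show ?thesis using i by blast
        qed
      next
        case False
        then show ?thesis using x by (auto simp: B_def N'_def N_def)
      qed
    qed
  qed
qed

text \<open>
  The supremum of all such \<open>c\<close> is the upper derivate of \<open>f\<close> at \<open>x\<close> over intervals containing \<open>x\<close>. Slopes at most \<open>p\<close> are expressed as slopes at least \<open>- p\<close> of \<open>- f\<close>, which spares
  a second notion and lets each statement be used twice.
\<close>

definition steep_at :: "(real \<Rightarrow> real) \<Rightarrow> real \<Rightarrow> real \<Rightarrow> bool"
where
  "steep_at f c x \<longleftrightarrow> (\<forall>d>0. \<exists>u v. u < v \<and> x \<in> {u..v} \<and> v - u < d \<and> c * (v - u) \<le> f v - f u)"

text \<open>
  With \<open>m\<close> the outer measure of the set, two nested finite Vitali covers \<open>I\<close> and \<open>J\<close> have total lengths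
  within a few \<open>e\<close> of \<open>m\<close>, and the sums of increments over them differ by less than \<open>h\<close>; comparing
  slopes gives \<open>q * m \<le> p * m\<close> up to an error that vanishes with \<open>h\<close>.
\<close>

lemma negligible_two_slopes:
  assumes ac: "abs_continuous_on a b f" and pq: "p < q"
  shows "negligible {x \<in> {a<..<b}. steep_at f q x \<and> steep_at (\<lambda>x. - f x) (- p) x}"
proof -
  let ?E = "{x \<in> {a<..<b}. steep_at f q x \<and> steep_at (\<lambda>x. - f x) (- p) x}"
  define M where "M = measure lebesgue ` {T \<in> lmeasurable. ?E \<subseteq> T}"
  define m where "m = Inf M"
  have "{a<..<b} \<in> lmeasurable" "?E \<subseteq> {a<..<b}"
    by auto
  then have Mne: "M \<noteq> {}"
    unfolding M_def by blast
  have bdd: "bdd_below M"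
    by (rule bdd_belowI[of _ 0]) (auto simp: M_def)
  have m_le: "m \<le> measure lebesgue T" if "T \<in> lmeasurable" "?E \<subseteq> T" for T
    unfolding m_def using that by (intro cInf_lower[OF _ bdd]) (auto simp: M_def)
  have m_near: "\<exists>T\<in>lmeasurable. ?E \<subseteq> T \<and> measure lebesgue T < m + e" if "0 < e" for e
    using cInf_lessD[OF Mne, of "m + e"] that by (auto simp: m_def M_def)
  have key: "(q - p) * m \<le> h * (1 + 3 * \<bar>q\<bar> + 2 * (q - p))" if h: "0 < h" for h
  proof -
    obtain d where d: "0 < d" and D: "\<And>I J :: (real \<times> real) set. \<lbrakk>finite I; finite J;
      \<And>u v. (u, v) \<in> I \<Longrightarrow> a \<le> u \<and> u < v \<and> v \<le> b;
      \<And>u v. (u, v) \<in> J \<Longrightarrow> u < v \<and> (\<exists>(u', v')\<in>I. u' \<le> u \<and> v \<le> v');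
      disjoint_family_on (\<lambda>(u, v). {u..v}) I; disjoint_family_on (\<lambda>(u, v). {u..v}) J;
      (\<Sum>(u, v)\<in>I. v - u) - (\<Sum>(u, v)\<in>J. v - u) < d\<rbrakk> \<Longrightarrow>
      \<bar>(\<Sum>(u, v)\<in>I. f v - f u) - (\<Sum>(u, v)\<in>J. f v - f u)\<bar> < h"
      using abs_continuous_on_gaps[OF ac h] by metis
    \<comment> \<open>the gaps between the two covers have total length below \<open>3 * e\<close>\<close>
    define e where "e = min h (d / 3)"
    have e: "0 < e" "e \<le> h" "3 * e \<le> d"
      using h d by (auto simp: e_def)
    obtain T where T: "T \<in> lmeasurable" "?E \<subseteq> T" "measure lebesgue T < m + e / 2"
      using m_near[of "e / 2"] e by auto
    obtain G where G: "open G" "T \<subseteq> G" "G \<in> lmeasurable" "measure lebesgue G < measure lebesgue T + e / 2"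
      using lmeasurable_outer_open[OF T(1), of "e / 2"] e by auto
    define W where "W = G \<inter> {a<..<b}"
    have W: "open W" "W \<subseteq> {a..b}" "?E \<subseteq> W"
      using G T by (auto simp: W_def)
    have mW: "W \<in> lmeasurable" "measure lebesgue W < m + e"
    proof -
      show "W \<in> lmeasurable"
        unfolding W_def by (rule lmeasurable_open) (use G in \<open>auto simp: bounded_Int\<close>)
      then have "measure lebesgue W \<le> measure lebesgue G"
        using G by (intro measure_mono_fmeasurable) (auto simp: W_def)
      then show "measure lebesgue W < m + e"
        using G T by simp
    qed
    obtain I R where I: "finite I" "\<And>u v. (u, v) \<in> I \<Longrightarrow> u < v \<and> {u..v} \<subseteq> W \<and> q * (v - u) \<le> f v - f u"
      and dI: "disjoint_family_on (\<lambda>(u, v). {u..v}) I"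
      and R: "R \<in> lmeasurable" "measure lebesgue R < e" "?E \<subseteq> R \<union> (\<Union>(u, v)\<in>I. {u<..<v})"
    proof (rule Vitali_finite_interval_cover[OF W])
      show "\<exists>u v. u < v \<and> x \<in> {u..v} \<and> v - u < d \<and> q * (v - u) \<le> f v - f u"
        if "x \<in> ?E" "0 < d" for x d
        using that unfolding steep_at_def by blast
    qed (use e in auto)
    define W2 where "W2 = (\<Union>(u, v)\<in>I. {u<..<v})"
    have W2: "open W2" "W2 \<subseteq> {a..b}" "?E \<inter> W2 \<subseteq> W2"
    proof -
      show "open W2" by (auto simp: W2_def)
      show "W2 \<subseteq> {a..b}"
      proof
        fix x assume "x \<in> W2"
        then obtain u v where "(u, v) \<in> I" "x \<in> {u..v}"
          by (auto simp: W2_def)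
        then show "x \<in> {a..b}" using I(2)[of u v] W(2) by blast
      qed
    qed auto
    obtain J R2 where J: "finite J" "\<And>u v. (u, v) \<in> J \<Longrightarrow> u < v \<and> {u..v} \<subseteq> W2 \<and>
          (f v - f u \<le> p * (v - u) \<and> (\<exists>(u', v')\<in>I. u' \<le> u \<and> v \<le> v'))"
      and dJ: "disjoint_family_on (\<lambda>(u, v). {u..v}) J"
      and R2: "R2 \<in> lmeasurable" "measure lebesgue R2 < e" "?E \<inter> W2 \<subseteq> R2 \<union> (\<Union>(u, v)\<in>J. {u<..<v})"
    proof (rule Vitali_finite_interval_cover[OF W2])
      fix x c :: real assume x: "x \<in> ?E \<inter> W2" "0 < c"
      then obtain u' v' where uv': "(u', v') \<in> I" "u' < x" "x < v'"
        by (auto simp: W2_def)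
      obtain u v where "u < v" "x \<in> {u..v}" "v - u < min c (min (x - u') (v' - x))"
        "- p * (v - u) \<le> - f v - - f u"
        using x uv' unfolding steep_at_def by (auto dest!: spec[of _ "min c (min (x - u') (v' - x))"])
      then show "\<exists>u v. u < v \<and> x \<in> {u..v} \<and> v - u < c \<and>
          (f v - f u \<le> p * (v - u) \<and> (\<exists>(u', v')\<in>I. u' \<le> u \<and> v \<le> v'))"
        using uv' by (intro exI[of _ u] exI[of _ v]) (force intro!: bexI[of _ "(u', v')"])
    qed (use e in auto)
    have sumI: "(\<Sum>(u, v)\<in>I. v - u) < m + e"
    proof -
      have "(\<Sum>i\<in>I. snd i - fst i) \<le> measure lebesgue W"
      proof (rule disjoint_intervals_length_le[OF I(1) _ _ mW(1)])
        show "fst i \<le> snd i \<and> {fst i<..<snd i} \<subseteq> W" if "i \<in> I" for i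
          using I(2)[of "fst i" "snd i"] that by auto
        show "disjoint_family_on (\<lambda>i. {fst i<..<snd i}) I"
          using dI unfolding disjoint_family_on_def by (fastforce simp: split_beta)
      qed
      then show ?thesis
        using mW by (simp add: split_beta)
    qed
    have sumJ: "m - 2 * e \<le> (\<Sum>(u, v)\<in>J. v - u)"
    proof -
      let ?U = "\<Union>(u, v)\<in>J. {u<..<v}"
      have lmU: "?U \<in> lmeasurable"
        using J(1) by (auto intro!: fmeasurable.finite_UN)
      have "?E \<subseteq> (R \<union> R2) \<union> ?U"
        using R(3) R2(3) by (auto simp: W2_def)
      then have "m \<le> measure lebesgue ((R \<union> R2) \<union> ?U)"
        using R R2 lmU by (intro m_le fmeasurable.Un)
      also have "\<dots> \<le> measure lebesgue (R \<union> R2) + measure lebesgue ?U"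
        using R R2 lmU by (intro measure_Un_le) (auto dest: fmeasurableD)
      also have "\<dots> \<le> (measure lebesgue R + measure lebesgue R2) + measure lebesgue ?U"
        using R R2 by (intro add_right_mono measure_Un_le) (auto dest: fmeasurableD)
      also have "measure lebesgue ?U \<le> (\<Sum>i\<in>J. measure lebesgue (case i of (u, v) \<Rightarrow> {u<..<v}))"
        using J(1) by (intro measure_UNION_le) auto
      also have "\<dots> = (\<Sum>(u, v)\<in>J. v - u)"
        using J(2) by (intro sum.cong refl) (force simp: split_beta)
      finally show ?thesis using R R2 by simp
    qed
    have "\<bar>(\<Sum>(u, v)\<in>I. f v - f u) - (\<Sum>(u, v)\<in>J. f v - f u)\<bar> < h"
    proof (rule D[OF I(1) J(1)])
      show "a \<le> u \<and> u < v \<and> v \<le> b" if "(u, v) \<in> I" for u v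
      proof -
        have "u < v" "{u..v} \<subseteq> {a..b}" using I(2)[OF that] W(2) by blast+
        then show ?thesis by auto
      qed
      show "u < v \<and> (\<exists>(u', v')\<in>I. u' \<le> u \<and> v \<le> v')" if "(u, v) \<in> J" for u v
        using J(2)[OF that] by blast
      show "(\<Sum>(u, v)\<in>I. v - u) - (\<Sum>(u, v)\<in>J. v - u) < d"
        using sumI sumJ e by simp
    qed (fact dI dJ)+
    moreover have "q * (\<Sum>(u, v)\<in>I. v - u) \<le> (\<Sum>(u, v)\<in>I. f v - f u)"
      unfolding sum_distrib_left using I(2) by (intro sum_mono) auto
    moreover have "(\<Sum>(u, v)\<in>J. f v - f u) \<le> p * (\<Sum>(u, v)\<in>J. v - u)"
      unfolding sum_distrib_left using J(2) by (intro sum_mono) auto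
    ultimately have le: "q * (\<Sum>(u, v)\<in>I. v - u) \<le> p * (\<Sum>(u, v)\<in>J. v - u) + h"
      by linarith
    have sumIJ: "m - e \<le> (\<Sum>(u, v)\<in>I. v - u)"
    proof -
      let ?U = "\<Union>(u, v)\<in>I. {u<..<v}"
      have lmU: "?U \<in> lmeasurable"
        using I(1) by (auto intro!: fmeasurable.finite_UN)
      have "m \<le> measure lebesgue (R \<union> ?U)"
        using R lmU by (intro m_le fmeasurable.Un)
      also have "\<dots> \<le> measure lebesgue R + measure lebesgue ?U"
        using R lmU by (intro measure_Un_le) (auto dest: fmeasurableD)
      also have "measure lebesgue ?U \<le> (\<Sum>i\<in>I. measure lebesgue (case i of (u, v) \<Rightarrow> {u<..<v}))"
        using I(1) by (intro measure_UNION_le) auto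
      also have "\<dots> = (\<Sum>(u, v)\<in>I. v - u)"
        using I(2) by (intro sum.cong refl) (force simp: split_beta)
      finally show ?thesis using R by simp
    qed
    define SI SJ where "SI = (\<Sum>(u, v)\<in>I. v - u)" and "SJ = (\<Sum>(u, v)\<in>J. v - u)"
    have S: "m - 2 * e \<le> SJ" "q * SI \<le> p * SJ + h"
      using sumJ le by (auto simp: SI_def SJ_def)
    have SJI: "\<bar>SI - SJ\<bar> \<le> 3 * e"
    proof -
      have "SJ \<le> measure lebesgue W"
      proof -
        have "(\<Sum>i\<in>J. snd i - fst i) \<le> measure lebesgue W"
        proof (rule disjoint_intervals_length_le[OF J(1) _ _ mW(1)])
          show "fst i \<le> snd i \<and> {fst i<..<snd i} \<subseteq> W" if "i \<in> J" for i
          proof -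
            have "W2 \<subseteq> W" using I(2) by (force simp: W2_def)
            moreover have "{fst i<..<snd i} \<subseteq> {fst i..snd i}" by auto
            ultimately show ?thesis
              using J(2)[of "fst i" "snd i"] that by fastforce
          qed
          show "disjoint_family_on (\<lambda>i. {fst i<..<snd i}) J"
            using dJ unfolding disjoint_family_on_def by (fastforce simp: split_beta)
        qed
        then show ?thesis by (simp add: SJ_def split_beta)
      qed
      then show ?thesis
        using sumI sumJ sumIJ mW e unfolding SI_def[symmetric] SJ_def[symmetric] by linarith
    qed
    have "(q - p) * SJ \<le> h + \<bar>q\<bar> * (3 * e)"
    proof -
      have "q * (SJ - SI) \<le> \<bar>q\<bar> * (3 * e)"
        using SJI by (metis abs_ge_self abs_minus_commute abs_mult abs_ge_zero mult_left_mono order_trans)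
      then show ?thesis using S(2) by (simp add: algebra_simps)
    qed
    moreover have "(q - p) * (m - 2 * e) \<le> (q - p) * SJ"
      using S(1) pq by (intro mult_left_mono) auto
    ultimately have "(q - p) * m \<le> h + (3 * \<bar>q\<bar> + 2 * (q - p)) * e"
      by (simp add: algebra_simps)
    also have "(3 * \<bar>q\<bar> + 2 * (q - p)) * e \<le> (3 * \<bar>q\<bar> + 2 * (q - p)) * h"
      using e pq by (intro mult_left_mono) auto
    finally show ?thesis by (simp add: algebra_simps)
  qed
  have "(q - p) * m \<le> 0"
  proof (rule ccontr)
    define c where "c = 1 + 3 * \<bar>q\<bar> + 2 * (q - p)"
    assume "\<not> ?thesis"
    then have pos: "0 < (q - p) * m" by simp
    have c: "0 < c" using pq by (simp add: c_def add_pos_nonneg)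
    have "(q - p) * m \<le> (q - p) * m / (2 * c) * c"
      unfolding c_def[symmetric] using key[of "(q - p) * m / (2 * c)"] pos c by (simp add: c_def)
    also have "\<dots> = (q - p) * m / 2" using c by simp
    finally show False using pos by linarith
  qed
  then have "m \<le> 0"
    using pq by (simp add: mult_le_0_iff)
  show ?thesis
    unfolding negligible_outer
  proof (intro allI impI)
    fix e :: real assume "0 < e"
    then obtain T where "T \<in> lmeasurable" "?E \<subseteq> T" "measure lebesgue T < m + e"
      using m_near by blast
    then show "\<exists>T. ?E \<subseteq> T \<and> T \<in> lmeasurable \<and> measure lebesgue T < e"
      using \<open>m \<le> 0\<close> by (intro exI[of _ T]) simp
  qed
qed

lemma steep_at_mono: "steep_at f c x \<Longrightarrow> c' \<le> c \<Longrightarrow> steep_at f c' x"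
  unfolding steep_at_def
  by (meson diff_ge_0_iff_ge less_imp_le mult_right_mono order_trans)

lemma steep_at_cases: "steep_at f c x \<or> steep_at (\<lambda>x. - f x) (- c) x"
proof (rule disjCI)
  assume "\<not> steep_at (\<lambda>x. - f x) (- c) x"
  then obtain d where d: "0 < d" and
    D: "\<And>u v. u < v \<Longrightarrow> x \<in> {u..v} \<Longrightarrow> v - u < d \<Longrightarrow> - f v - - f u < - c * (v - u)"
    unfolding steep_at_def by (meson not_le)
  show "steep_at f c x"
    unfolding steep_at_def
  proof (intro allI impI)
    fix e :: real assume "0 < e"
    define v where "v = x + min d e / 2"
    have v: "x < v" "v - x < d" "v - x < e"
      using d \<open>0 < e\<close> by (auto simp: v_def min_def field_simps)
    then have "c * (v - x) \<le> f v - f x"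
      using D[of x v] by simp
    then show "\<exists>u v. u < v \<and> x \<in> {u..v} \<and> v - u < e \<and> c * (v - u) \<le> f v - f u"
      using v by (intro exI[of _ x] exI[of _ v]) auto
  qed
qed

text \<open>
  Within a window shorter than the modulus \<open>d\<close> of absolute continuity for \<open>1\<close>, disjoint intervals of
  slope at least \<open>n\<close> have total length below \<open>1 / n\<close>, because their increments add up to less than
  \<open>1\<close>; countably many windows cover the interval.
\<close>

lemma negligible_infinite_slope:
  assumes ac: "abs_continuous_on a b f"
  shows "negligible {x \<in> {a<..<b}. \<forall>n::nat. steep_at f (real n) x}" (is "negligible ?E")
proof -
  obtain d where d: "0 < d" and D:
    "\<And>(S :: (real \<times> real) set) u v. finite S \<Longrightarrow> (\<And>i. i \<in> S \<Longrightarrow> a \<le> u i \<and> u i \<le> v i \<and> v i \<le> b) \<Longrightarrow>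
      disjoint_family_on (\<lambda>i. {u i<..<v i}) S \<Longrightarrow> (\<Sum>i\<in>S. v i - u i) < d \<Longrightarrow>
      (\<Sum>i\<in>S. \<bar>f (v i) - f (u i)\<bar>) < 1"
    using abs_continuous_on_family[OF ac zero_less_one] by blast
  have loc: "negligible (?E \<inter> {c<..<c + d / 2})" for c
    unfolding negligible_outer
  proof (intro allI impI)
    fix e :: real assume e: "0 < e"
    obtain n :: nat where n: "2 / e < real n"
      using reals_Archimedean2 by blast
    moreover have "0 < 2 / e" using e by simp
    ultimately have n0: "0 < real n" by linarith
    have n1: "1 / real n < e / 2"
      using n n0 e by (simp add: field_simps)
    define W where "W = {c<..<c + d / 2} \<inter> {a<..<b}"
    have W: "open W" "W \<subseteq> {a..b}" "?E \<inter> {c<..<c + d / 2} \<subseteq> W"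
      by (auto simp: W_def)
    obtain I R where I: "finite I" "\<And>u v. (u, v) \<in> I \<Longrightarrow> u < v \<and> {u..v} \<subseteq> W \<and> real n * (v - u) \<le> f v - f u"
      and dI: "disjoint_family_on (\<lambda>(u, v). {u..v}) I"
      and R: "R \<in> lmeasurable" "measure lebesgue R < e / 2"
        "?E \<inter> {c<..<c + d / 2} \<subseteq> R \<union> (\<Union>(u, v)\<in>I. {u<..<v})"
    proof (rule Vitali_finite_interval_cover[OF W, where e = "e / 2"])
      show "\<exists>u v. u < v \<and> x \<in> {u..v} \<and> v - u < r \<and> real n * (v - u) \<le> f v - f u"
        if "x \<in> ?E \<inter> {c<..<c + d / 2}" "0 < r" for x r
        using that unfolding steep_at_def by blast
    qed (use e in auto)
    let ?U = "\<Union>(u, v)\<in>I. {u<..<v}"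
    have lmU: "?U \<in> lmeasurable"
      using I(1) by (auto intro!: fmeasurable.finite_UN)
    have dI': "disjoint_family_on (\<lambda>i. {fst i<..<snd i}) I"
      using dI unfolding disjoint_family_on_def by (fastforce simp: split_beta)
    have IW: "fst i < snd i" "{fst i..snd i} \<subseteq> W" "real n * (snd i - fst i) \<le> f (snd i) - f (fst i)" if "i \<in> I" for i
      using I(2)[of "fst i" "snd i"] that by auto
    have "(\<Sum>i\<in>I. \<bar>f (snd i) - f (fst i)\<bar>) < 1"
    proof (rule D[OF I(1) _ dI'])
      show "a \<le> fst i \<and> fst i \<le> snd i \<and> snd i \<le> b" if "i \<in> I" for i
        using IW[OF that] W(2) by (meson atLeastAtMost_iff less_imp_le order_refl subsetD)
      have "(\<Sum>i\<in>I. snd i - fst i) \<le> measure lebesgue {c<..<c + d / 2}"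
      proof (rule disjoint_intervals_length_le[OF I(1) _ dI'])
        fix i assume "i \<in> I"
        moreover have "{fst i<..<snd i} \<subseteq> {fst i..snd i}" by auto
        ultimately show "fst i \<le> snd i \<and> {fst i<..<snd i} \<subseteq> {c<..<c + d / 2}"
          using IW[of i] by (auto simp: W_def)
      qed simp
      then show "(\<Sum>i\<in>I. snd i - fst i) < d" using d by simp
    qed
    moreover have "real n * (\<Sum>i\<in>I. snd i - fst i) \<le> (\<Sum>i\<in>I. \<bar>f (snd i) - f (fst i)\<bar>)"
      unfolding sum_distrib_left using IW by (intro sum_mono) (meson abs_ge_self order_trans)
    ultimately have "real n * (\<Sum>i\<in>I. snd i - fst i) < 1" by linarith
    then have "(\<Sum>i\<in>I. snd i - fst i) < 1 / real n"
      using n0 by (subst pos_less_divide_eq) (simp_all add: mult.commute)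
    then have small: "(\<Sum>i\<in>I. snd i - fst i) < e / 2"
      using n1 by linarith
    have "measure lebesgue (R \<union> ?U) \<le> measure lebesgue R + measure lebesgue ?U"
      using R lmU by (intro measure_Un_le) (auto dest: fmeasurableD)
    also have "measure lebesgue ?U \<le> (\<Sum>i\<in>I. measure lebesgue (case i of (u, v) \<Rightarrow> {u<..<v}))"
      using I(1) by (intro measure_UNION_le) auto
    also have "\<dots> = (\<Sum>i\<in>I. snd i - fst i)"
      using IW(1) by (intro sum.cong refl) (force simp: split_beta)
    finally have "measure lebesgue (R \<union> ?U) < e"
      using R(2) small by simp
    then show "\<exists>T. ?E \<inter> {c<..<c + d / 2} \<subseteq> T \<and> T \<in> lmeasurable \<and> measure lebesgue T < e"
      using R lmU by (intro exI[of _ "R \<union> ?U"]) (auto intro: fmeasurable.Un)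
  qed
  have "negligible (\<Union>c\<in>\<rat>. ?E \<inter> {c<..<c + d / 2})"
    using loc countable_rat by (intro negligible_countable_Union) auto
  moreover have "?E \<subseteq> (\<Union>c\<in>\<rat>. ?E \<inter> {c<..<c + d / 2})"
  proof
    fix x assume x: "x \<in> ?E"
    obtain c where "c \<in> \<rat>" "x - d / 2 < c" "c < x"
      using Rats_dense_in_real[of "x - d / 2" x] d by auto
    then show "x \<in> (\<Union>c\<in>\<rat>. ?E \<inter> {c<..<c + d / 2})"
      using x by (intro UN_I[of c]) auto
  qed
  ultimately show ?thesis
    by (rule negligible_subset)
qed

text \<open>
  The derivative is the supremum \<open>D\<close> of all \<open>c\<close> with \<open>steep_at f c x\<close>, finite by the last two
  assumptions. Near \<open>x\<close> slopes stay below \<open>D + e\<close> by the choice of \<open>D\<close>, and above \<open>D - e\<close> by the first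
  assumption, applied to rational numbers between \<open>D - e\<close> and \<open>D\<close>.
\<close>

lemma differentiable_if_slopes_agree:
  assumes no_gap: "\<And>p q. p \<in> \<rat> \<Longrightarrow> q \<in> \<rat> \<Longrightarrow> p < q \<Longrightarrow> \<not> (steep_at f q x \<and> steep_at (\<lambda>x. - f x) (- p) x)"
    and above: "\<not> steep_at f (real n) x" and below: "\<not> steep_at (\<lambda>x. - f x) (real k) x"
  shows "\<exists>D. (f has_real_derivative D) (at x)"
proof -
  define A where "A = {c. steep_at f c x}"
  have "- real k \<in> A"
    using steep_at_cases[of f "- real k" x] below by (auto simp: A_def)
  then have Ane: "A \<noteq> {}" by blast
  have bdd: "bdd_above A"
    using above steep_at_mono[of f _ x "real n"] by (intro bdd_aboveI[of _ "real n"]) (force simp: A_def)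
  define D where "D = Sup A"
  have "((\<lambda>y. (f y - f x) / (y - x)) \<longlongrightarrow> D) (at x)"
  proof (rule LIM_I)
    fix e :: real assume e: "0 < e"
    obtain q where q: "q \<in> \<rat>" "D - e / 2 < q" "q < D"
      using Rats_dense_in_real[of "D - e / 2" D] e by auto
    obtain p where p: "p \<in> \<rat>" "D - e < p" "p < q"
      using Rats_dense_in_real[of "D - e" q] e q by auto
    have "steep_at f q x"
    proof -
      obtain c where "c \<in> A" "q < c"
        using q less_cSup_iff[OF Ane bdd, of q] by (auto simp: D_def)
      then show ?thesis by (auto simp: A_def intro: steep_at_mono)
    qed
    then have "\<not> steep_at (\<lambda>x. - f x) (- p) x"
      using no_gap p q by blast
    then obtain d1 where d1: "0 < d1" and
      D1: "\<And>u v. u < v \<Longrightarrow> x \<in> {u..v} \<Longrightarrow> v - u < d1 \<Longrightarrow> - f v - - f u < - p * (v - u)"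
      unfolding steep_at_def by (meson not_le)
    have "\<not> steep_at f (D + e) x"
      using cSup_upper[OF _ bdd, of "D + e"] e by (auto simp: A_def D_def)
    then obtain d2 where d2: "0 < d2" and
      D2: "\<And>u v. u < v \<Longrightarrow> x \<in> {u..v} \<Longrightarrow> v - u < d2 \<Longrightarrow> f v - f u < (D + e) * (v - u)"
      unfolding steep_at_def by (meson not_le)
    show "\<exists>s>0. \<forall>y. y \<noteq> x \<and> norm (y - x) < s \<longrightarrow> norm ((f y - f x) / (y - x) - D) < e"
    proof (intro exI[of _ "min d1 d2"] conjI allI impI)
      show "0 < min d1 d2" using d1 d2 by simp
      fix y assume y: "y \<noteq> x \<and> norm (y - x) < min d1 d2"
      let ?u = "min x y" and ?v = "max x y"
      have "?v - ?u = \<bar>y - x\<bar>"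
        by (auto simp: min_def max_def)
      then have uv: "?u < ?v" "x \<in> {?u..?v}" "?v - ?u < d1" "?v - ?u < d2"
        using y by auto
      have eq: "(f y - f x) / (y - x) = (f ?v - f ?u) / (?v - ?u)"
        using y by (auto simp: min_def max_def field_simps)
      have "(f ?v - f ?u) / (?v - ?u) < D + e"
        using D2[OF uv(1,2,4)] uv(1) by (simp add: pos_divide_less_eq)
      moreover have "p < (f ?v - f ?u) / (?v - ?u)"
        using D1[OF uv(1,2,3)] uv(1) by (simp add: pos_less_divide_eq)
      ultimately show "norm ((f y - f x) / (y - x) - D) < e"
        using p unfolding eq by (simp add: abs_less_iff)
    qed
  qed
  then show ?thesis
    by (auto simp: has_field_derivative_iff)
qed

lemma abs_continuous_on_differentiable_ae:
  assumes ac: "abs_continuous_on a b f"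
  shows "negligible {x \<in> {a<..<b}. \<nexists>D. (f has_real_derivative D) (at x)}"
proof (rule negligible_subset)
  let ?G = "\<lambda>p q. {x \<in> {a<..<b}. steep_at f q x \<and> steep_at (\<lambda>x. - f x) (- p) x}"
  let ?I = "\<lambda>f. {x \<in> {a<..<b}. \<forall>n::nat. steep_at f (real n) x}"
  let ?S = "{(p, q). p \<in> \<rat> \<and> q \<in> \<rat> \<and> p < (q::real)}"
  have "?S \<subseteq> \<rat> \<times> \<rat>" by auto
  then have "countable ?S"
    by (rule countable_subset) (simp add: countable_rat)
  then have "negligible (\<Union>(p, q)\<in>?S. ?G p q)"
    using negligible_two_slopes[OF ac] by (intro negligible_countable_Union) auto
  then show "negligible ((\<Union>(p, q)\<in>?S. ?G p q) \<union> (?I f \<union> ?I (\<lambda>x. - f x)))"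
    using negligible_infinite_slope[OF ac] negligible_infinite_slope[OF abs_continuous_on_uminus[OF ac]]
    by (intro negligible_Un)
  show "{x \<in> {a<..<b}. \<nexists>D. (f has_real_derivative D) (at x)} \<subseteq>
      (\<Union>(p, q)\<in>?S. ?G p q) \<union> (?I f \<union> ?I (\<lambda>x. - f x))"
  proof
    fix x assume x: "x \<in> {x \<in> {a<..<b}. \<nexists>D. (f has_real_derivative D) (at x)}"
    show "x \<in> (\<Union>(p, q)\<in>?S. ?G p q) \<union> (?I f \<union> ?I (\<lambda>x. - f x))"
    proof (rule ccontr)
      assume "x \<notin> (\<Union>(p, q)\<in>?S. ?G p q) \<union> (?I f \<union> ?I (\<lambda>x. - f x))"
      then have no: "\<And>p q. p \<in> \<rat> \<Longrightarrow> q \<in> \<rat> \<Longrightarrow> p < q \<Longrightarrow> \<not> (steep_at f q x \<and> steep_at (\<lambda>x. - f x) (- p) x)"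
        and "\<exists>n::nat. \<not> steep_at f (real n) x" "\<exists>n::nat. \<not> steep_at (\<lambda>x. - f x) (real n) x"
        using x by blast+
      then show False
        using differentiable_if_slopes_agree[of f x] x by blast
    qed
  qed
qed

section \<open>The derivative as an integrand\<close>

text \<open>
  The gauge forces intervals tagged outside \<open>N\<close> to be so short that the increment is close to the
  derivative times the length, and intervals tagged in \<open>N\<close> into an open set of small measure, where
  their increments are small in total by absolute continuity.
\<close>

lemma abs_continuous_on_has_integral:
  fixes f g :: "real \<Rightarrow> real"
  assumes ac: "abs_continuous_on a b f" and ab: "a \<le> b" and N: "negligible N"
    and der: "\<And>x. x \<in> {a..b} - N \<Longrightarrow> (f has_real_derivative g x) (at x within {a..b})"
  shows "(g has_integral f b - f a) {a..b}"
proof -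
  define g' where "g' x = (if x \<in> N then 0 else g x)" for x
  have "(g' has_integral f b - f a) {a..b}"
  proof (cases "a = b")
    case True
    then show ?thesis
      using has_integral_refl(2)[of g' a] by simp
  next
    case False
    with ab have ab': "a < b" by simp
    show ?thesis
      unfolding has_integral_factor_content_real
    proof (intro allI impI)
      fix e :: real assume e: "0 < e"
      have h: "0 < e / 2 * (b - a)" using e ab' by simp
      obtain d where d: "0 < d" and D:
        "\<And>(S :: (real \<times> real set) set) u v. finite S \<Longrightarrow> (\<And>i. i \<in> S \<Longrightarrow> a \<le> u i \<and> u i \<le> v i \<and> v i \<le> b) \<Longrightarrow>
          disjoint_family_on (\<lambda>i. {u i<..<v i}) S \<Longrightarrow> (\<Sum>i\<in>S. v i - u i) < d \<Longrightarrow>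
          (\<Sum>i\<in>S. \<bar>f (v i) - f (u i)\<bar>) < e / 2 * (b - a)"
        using abs_continuous_on_family[OF ac h] by blast
      have Nm: "N \<in> lmeasurable" "measure lebesgue N = 0"
        using N by (auto simp: negligible_iff_measure)
      obtain G where G: "open G" "N \<subseteq> G" "G \<in> lmeasurable" "measure lebesgue G < d"
        using lmeasurable_outer_open[OF Nm(1) d] Nm(2) by auto
      have "\<forall>x. \<exists>r>0. x \<in> {a..b} - N \<longrightarrow>
          (\<forall>y\<in>{a..b}. \<bar>y - x\<bar> < r \<longrightarrow> \<bar>f y - f x - g x * (y - x)\<bar> \<le> e / 2 * \<bar>y - x\<bar>)"
      proof
        fix x
        show "\<exists>r>0. x \<in> {a..b} - N \<longrightarrow>
          (\<forall>y\<in>{a..b}. \<bar>y - x\<bar> < r \<longrightarrow> \<bar>f y - f x - g x * (y - x)\<bar> \<le> e / 2 * \<bar>y - x\<bar>)"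
        proof (cases "x \<in> {a..b} - N")
          case True
          then show ?thesis
            using der[OF True] e unfolding has_field_derivative_def has_derivative_within_alt
            by (auto dest!: spec[of _ "e / 2"])
        qed (auto intro: exI[of _ 1])
      qed
      then obtain r where r: "\<And>x. 0 < r x" and
        R: "\<And>x y. x \<in> {a..b} - N \<Longrightarrow> y \<in> {a..b} \<Longrightarrow> \<bar>y - x\<bar> < r x \<Longrightarrow>
            \<bar>f y - f x - g x * (y - x)\<bar> \<le> e / 2 * \<bar>y - x\<bar>"
        by metis
      define \<gamma> where "\<gamma> x = (if x \<in> N then G else ball x (r x))" for x
      have "gauge \<gamma>"
        using G r by (auto simp: gauge_def \<gamma>_def)
      moreover have "norm ((\<Sum>(x, K)\<in>p. measure lborel K *\<^sub>R g' x) - (f b - f a)) \<le> e * measure lborel {a..b}"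
        if p: "p tagged_division_of {a..b}" "\<gamma> fine p" for p
      proof -
        note pD = tagged_division_ofD[OF p(1)]
        have KI: "\<exists>u v. K = {u..v} \<and> u \<le> x \<and> x \<le> v \<and> a \<le> u \<and> v \<le> b \<and> K \<subseteq> \<gamma> x" if "(x, K) \<in> p" for x K
        proof -
          obtain u v where "K = {u..v}" using pD(4)[OF \<open>(x, K) \<in> p\<close>] by auto
          then show ?thesis
            using pD(2,3)[OF \<open>(x, K) \<in> p\<close>] p(2) that by (auto simp: fine_def)
        qed
        define P where "P = {(x, K) \<in> p. x \<in> N}"
        have P: "P \<subseteq> p" "finite P" "finite (p - P)"
          using pD(1) by (auto simp: P_def intro: finite_subset)
        have dis: "disjoint_family_on (\<lambda>i. {Inf (snd i)<..<Sup (snd i)}) P"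
          unfolding disjoint_family_on_def
        proof (intro ballI impI)
          fix i j assume ij: "i \<in> P" "j \<in> P" "i \<noteq> j"
          obtain x K y L where xy: "i = (x, K)" "j = (y, L)" by (cases i, cases j) auto
          have in_p: "(x, K) \<in> p" "(y, L) \<in> p" using ij xy by (auto simp: P_def)
          obtain u v u' v' where "K = {u..v}" "u \<le> v" "L = {u'..v'}" "u' \<le> v'"
            using KI[OF in_p(1)] KI[OF in_p(2)] by (metis order_trans)
          then show "{Inf (snd i)<..<Sup (snd i)} \<inter> {Inf (snd j)<..<Sup (snd j)} = {}"
            using pD(5)[OF in_p] ij xy by (simp add: interior_atLeastAtMost_real)
        qed
        have "(\<Sum>i\<in>P. \<bar>f (Sup (snd i)) - f (Inf (snd i))\<bar>) < e / 2 * (b - a)"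
        proof (rule D[OF P(2) _ dis])
          fix i assume "i \<in> P"
          then obtain x K where i: "i = (x, K)" "(x, K) \<in> p" by (cases i) (auto simp: P_def)
          then show "a \<le> Inf (snd i) \<and> Inf (snd i) \<le> Sup (snd i) \<and> Sup (snd i) \<le> b"
            using KI[OF i(2)] by auto
        next
          have "(\<Sum>i\<in>P. Sup (snd i) - Inf (snd i)) \<le> measure lebesgue G"
          proof (rule disjoint_intervals_length_le[OF P(2) _ dis G(3)])
            fix i assume "i \<in> P"
            then obtain x K where i: "i = (x, K)" "(x, K) \<in> p" "x \<in> N" by (cases i) (auto simp: P_def)
            then obtain u v where "K = {u..v}" "u \<le> v" "K \<subseteq> G"
              using KI[OF i(2)] by (force simp: \<gamma>_def)
            then show "Inf (snd i) \<le> Sup (snd i) \<and> {Inf (snd i)<..<Sup (snd i)} \<subseteq> G"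
              using i by auto
          qed
          then show "(\<Sum>i\<in>P. Sup (snd i) - Inf (snd i)) < d"
            using G(4) by simp
        qed
        moreover have "(\<Sum>i\<in>P. \<bar>measure lborel (snd i) * g' (fst i) - (f (Sup (snd i)) - f (Inf (snd i)))\<bar>) =
            (\<Sum>i\<in>P. \<bar>f (Sup (snd i)) - f (Inf (snd i))\<bar>)"
          by (intro sum.cong refl) (auto simp: P_def g'_def)
        moreover have "(\<Sum>i\<in>p - P. \<bar>measure lborel (snd i) * g' (fst i) - (f (Sup (snd i)) - f (Inf (snd i)))\<bar>) \<le>
            (\<Sum>i\<in>p - P. e / 2 * measure lborel (snd i))"
        proof (rule sum_mono)
          fix i assume "i \<in> p - P"
          then obtain x K where i: "i = (x, K)" "(x, K) \<in> p" "x \<notin> N" by (cases i) (auto simp: P_def)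
          obtain u v where K: "K = {u..v}" "u \<le> x" "x \<le> v" "a \<le> u" "v \<le> b" "K \<subseteq> ball x (r x)"
            using KI[OF i(2)] i(3) by (auto simp: \<gamma>_def)
          have "u \<in> {u..v}" "v \<in> {u..v}" using K by auto
          then have "u \<in> ball x (r x)" "v \<in> ball x (r x)" using K(1,6) by blast+
          then have "\<bar>u - x\<bar> < r x" "\<bar>v - x\<bar> < r x"
            by (simp_all add: dist_real_def abs_minus_commute)
          then have "\<bar>f u - f x - g x * (u - x)\<bar> \<le> e / 2 * \<bar>u - x\<bar>" "\<bar>f v - f x - g x * (v - x)\<bar> \<le> e / 2 * \<bar>v - x\<bar>"
            using R[of x u] R[of x v] K(2-5) i(3) by (simp_all del: abs_le_iff)
          moreover have "e / 2 * \<bar>u - x\<bar> + e / 2 * \<bar>v - x\<bar> = e / 2 * (v - u)"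
          proof -
            have "\<bar>u - x\<bar> + \<bar>v - x\<bar> = v - u" using K by simp
            then show ?thesis by (simp only: distrib_left[symmetric])
          qed
          moreover have "(v - u) * g x - (f v - f u) = (f u - f x - g x * (u - x)) - (f v - f x - g x * (v - x))"
            by (simp add: algebra_simps)
          ultimately have "\<bar>(v - u) * g x - (f v - f u)\<bar> \<le> e / 2 * (v - u)"
            by linarith
          then show "\<bar>measure lborel (snd i) * g' (fst i) - (f (Sup (snd i)) - f (Inf (snd i)))\<bar> \<le> e / 2 * measure lborel (snd i)"
            using i K by (simp add: g'_def)
        qed
        moreover have "(\<Sum>i\<in>p - P. e / 2 * measure lborel (snd i)) \<le> e / 2 * (b - a)"
        proof -
          have "(\<Sum>i\<in>p - P. measure lborel (snd i)) \<le> (\<Sum>i\<in>p. measure lborel (snd i))"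
            using pD(1) by (intro sum_mono2) auto
          also have "\<dots> = b - a"
            using additive_content_tagged_division[of p a b] p(1) ab by (simp add: split_beta)
          finally have "e / 2 * (\<Sum>i\<in>p - P. measure lborel (snd i)) \<le> e / 2 * (b - a)"
            using e by (intro mult_left_mono) auto
          then show ?thesis by (simp add: sum_distrib_left)
        qed
        moreover have "(\<Sum>i\<in>p. \<bar>measure lborel (snd i) * g' (fst i) - (f (Sup (snd i)) - f (Inf (snd i)))\<bar>) =
            (\<Sum>i\<in>p - P. \<bar>measure lborel (snd i) * g' (fst i) - (f (Sup (snd i)) - f (Inf (snd i)))\<bar>) +
            (\<Sum>i\<in>P. \<bar>measure lborel (snd i) * g' (fst i) - (f (Sup (snd i)) - f (Inf (snd i)))\<bar>)"
          by (rule sum.subset_diff[OF P(1) pD(1)])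
        moreover have "(\<Sum>(x, K)\<in>p. measure lborel K *\<^sub>R g' x) - (f b - f a) =
            (\<Sum>i\<in>p. measure lborel (snd i) * g' (fst i) - (f (Sup (snd i)) - f (Inf (snd i))))"
          using additive_tagged_division_1[OF ab p(1), of f] by (simp add: split_beta sum_subtractf)
        moreover have "\<bar>\<Sum>i\<in>p. measure lborel (snd i) * g' (fst i) - (f (Sup (snd i)) - f (Inf (snd i)))\<bar> \<le>
            (\<Sum>i\<in>p. \<bar>measure lborel (snd i) * g' (fst i) - (f (Sup (snd i)) - f (Inf (snd i)))\<bar>)"
          by (rule sum_abs)
        moreover have "e * measure lborel {a..b} = e / 2 * (b - a) + e / 2 * (b - a)"
          using ab by simp
        ultimately show ?thesis
          by (simp only: real_norm_def)
      qed
      ultimately show "\<exists>\<gamma>. gauge \<gamma> \<and> (\<forall>p. p tagged_division_of {a..b} \<and> \<gamma> fine p \<longrightarrow>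
          norm ((\<Sum>(x, K)\<in>p. measure lborel K *\<^sub>R g' x) - (f b - f a)) \<le> e * measure lborel {a..b})"
        by (intro exI[of _ \<gamma>] conjI allI impI) simp_all
    qed
  qed
  then show ?thesis
    by (rule has_integral_spike[OF N, rotated]) (auto simp: g'_def)
qed

text \<open>
  Henstock integrability of the derivative is strengthened to Lebesgue integrability by a lower bound
  that is required only at points of differentiability, as it comes from a differential inequality.
\<close>

lemma vector_derivative_absolutely_integrable:
  fixes f :: "real \<Rightarrow> real"
  assumes ac: "abs_continuous_on a b f" and ab: "a < b"
    and lb: "\<And>t D. t \<in> {a..b} \<Longrightarrow> (f has_real_derivative D) (at t within {a..b}) \<Longrightarrow> C \<le> D"
  shows "AE t in lebesgue. t \<in> {a..b} \<longrightarrow>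
      (f has_real_derivative vector_derivative f (at t within {a..b})) (at t within {a..b})" (is ?ae)
    and "set_integrable lebesgue {a..b} (\<lambda>t. vector_derivative f (at t within {a..b}))" (is ?int)
proof -
  let ?f' = "\<lambda>t. vector_derivative f (at t within {a..b})"
  define N where "N = {a, b} \<union> {t \<in> {a<..<b}. \<nexists>D. (f has_real_derivative D) (at t)}"
  have N: "negligible N"
    unfolding N_def using abs_continuous_on_differentiable_ae[OF ac] by (intro negligible_Un) auto
  have der: "(f has_real_derivative ?f' t) (at t within {a..b})" if "t \<in> {a..b} - N" for t
  proof -
    obtain D where "(f has_real_derivative D) (at t)"
      using \<open>t \<in> {a..b} - N\<close> by (force simp: N_def)
    then have D: "(f has_real_derivative D) (at t within {a..b})"
      by (rule has_field_derivative_at_within)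
    then have "?f' t = D"
      using that ab by (intro vector_derivative_within_closed_interval)
        (auto simp: has_real_derivative_iff_has_vector_derivative)
    then show ?thesis using D by simp
  qed
  have "AE t in lebesgue. t \<notin> N"
    using N by (intro AE_not_in) (simp add: negligible_iff_null_sets)
  then show ?ae
    by eventually_elim (use der in auto)
  define g where "g t = (if t \<in> N then C else ?f' t)" for t
  have "(?f' has_integral f b - f a) {a..b}"
    by (rule abs_continuous_on_has_integral[OF ac _ N der]) (use ab in auto)
  then have "(g has_integral f b - f a) {a..b}"
    by (rule has_integral_spike[OF N, rotated]) (simp add: g_def)
  then have "g integrable_on {a..b}" by blast
  moreover have "C \<le> g t" if "t \<in> {a..b}" for t
    using lb[OF that der] that by (auto simp: g_def)
  moreover have "(\<lambda>t. C) absolutely_integrable_on {a..b}"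
    by (intro absolutely_integrable_on_const) auto
  ultimately have "g absolutely_integrable_on {a..b}"
    by (intro absolutely_integrable_absolutely_integrable_lbound[of g _ "\<lambda>t. C"])
  then show ?int
    by (rule absolutely_integrable_spike[OF _ N]) (simp add: g_def)
qed

section \<open>Measurability\<close>

text \<open>
  For control spaces without a countable base the Borel sets of the product may exceed the product of
  the Borel sets, so that continuity of \<open>F\<close> alone does not give measurability of the composition.
  Compactness helps: \<open>{F > r}\<close> is the union of the compact sets \<open>{F \<ge> r + 1 / Suc n}\<close>, and each of
  these is covered by finitely many open boxes inside \<open>{F > r}\<close>.
\<close>

lemma borel_measurable_continuous_compact_box:
  fixes F :: "'a::topological_space \<Rightarrow> 'b::topological_space \<Rightarrow> 'c::topological_space \<Rightarrow> real"
  assumes cpt: "compact X" "compact Y" "compact Z"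
    and cont: "continuous_on (X \<times> Y \<times> Z) (\<lambda>(x, y, z). F x y z)"
    and abc: "a \<in> M \<rightarrow>\<^sub>M restrict_space borel X" "b \<in> M \<rightarrow>\<^sub>M restrict_space borel Y"
      "c \<in> M \<rightarrow>\<^sub>M restrict_space borel Z"
  shows "(\<lambda>w. F (a w) (b w) (c w)) \<in> borel_measurable M"
  unfolding borel_measurable_iff_greater
proof
  fix r :: real
  let ?B = "X \<times> Y \<times> Z"
  let ?f = "\<lambda>(x, y, z). F x y z"
  have abcX: "a w \<in> X" "b w \<in> Y" "c w \<in> Z" if "w \<in> space M" for w
    using that abc by (auto simp: measurable_restrict_space2_iff)
  have [measurable]: "a \<in> M \<rightarrow>\<^sub>M borel" "b \<in> M \<rightarrow>\<^sub>M borel" "c \<in> M \<rightarrow>\<^sub>M borel"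
    using abc by (auto simp: measurable_restrict_space2_iff)
  obtain G where G: "open G" "?B \<inter> ?f -` {r<..} = ?B \<inter> G"
    using continuous_openin_preimage_gen[OF cont, of "{r<..}"] by (auto simp: openin_open)
  define \<C> where "\<C> = {(A, B, C). open A \<and> open B \<and> open C \<and> A \<times> B \<times> C \<subseteq> G}"
  have cover: "\<exists>D\<subseteq>\<C>. finite D \<and> ?B \<inter> ?f -` {r + 1 / real (Suc n)..} \<subseteq> (\<Union>(A, B, C)\<in>D. A \<times> B \<times> C)"
    (is "\<exists>D\<subseteq>\<C>. finite D \<and> ?K \<subseteq> _") for n
  proof -
    have "closedin (top_of_set ?B) ?K"
      using continuous_closedin_preimage[OF cont, of "{r + 1 / real (Suc n)..}"] by simp
    then have "compact ?K"
      by (rule closedin_compact[rotated]) (intro compact_Times cpt)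
    moreover have "open (case i of (A, B, C) \<Rightarrow> A \<times> B \<times> C)" if "i \<in> \<C>" for i
      using that by (auto simp: \<C>_def intro!: open_Times)
    moreover have "?K \<subseteq> (\<Union>(A, B, C)\<in>\<C>. A \<times> B \<times> C)"
    proof
      fix z assume z: "z \<in> ?K"
      have "0 < 1 / real (Suc n)" by simp
      moreover have "r + 1 / real (Suc n) \<le> ?f z" using z by blast
      ultimately have "r < ?f z" by linarith
      then have "z \<in> ?B \<inter> ?f -` {r<..}" using z by blast
      then have "z \<in> G" using G by blast
      then obtain A W where A: "open A" "open W" "z \<in> A \<times> W" "A \<times> W \<subseteq> G"
        using open_prod_elim[OF G(1)] by blast
      then have "snd z \<in> W" by auto
      then obtain B C where "open B" "open C" "snd z \<in> B \<times> C" "B \<times> C \<subseteq> W"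
        using open_prod_elim[OF A(2)] by blast
      then have "(A, B, C) \<in> \<C>" "z \<in> A \<times> B \<times> C"
        using A by (auto simp: \<C>_def mem_Times_iff)
      then show "z \<in> (\<Union>(A, B, C)\<in>\<C>. A \<times> B \<times> C)" by blast
    qed
    ultimately obtain D where "D \<subseteq> \<C>" "finite D" "?K \<subseteq> (\<Union>(A, B, C)\<in>D. A \<times> B \<times> C)"
      by (rule compactE_image)
    then show ?thesis by blast
  qed
  then obtain D where D: "\<And>n. D n \<subseteq> \<C>" "\<And>n. finite (D n)"
    "\<And>n. ?B \<inter> ?f -` {r + 1 / real (Suc n)..} \<subseteq> (\<Union>(A, B, C)\<in>D n. A \<times> B \<times> C)"
    by metis
  have "{w \<in> space M. r < F (a w) (b w) (c w)} =
      (\<Union>n. \<Union>(A, B, C)\<in>D n. {w \<in> space M. a w \<in> A \<and> b w \<in> B \<and> c w \<in> C})" (is "?L = ?R")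
  proof
    show "?L \<subseteq> ?R"
    proof
      fix w assume "w \<in> ?L"
      then have w: "w \<in> space M" "r < F (a w) (b w) (c w)" by auto
      obtain n where "1 / real (Suc n) < F (a w) (b w) (c w) - r"
        using w(2) by (metis diff_gt_0_iff_gt nat_approx_posE)
      then have "(a w, b w, c w) \<in> ?B \<inter> ?f -` {r + 1 / real (Suc n)..}"
        using abcX[OF w(1)] by (simp del: of_nat_Suc)
      then have "(a w, b w, c w) \<in> (\<Union>(A, B, C)\<in>D n. A \<times> B \<times> C)"
        using D(3) by blast
      then show "w \<in> ?R" using w(1) by fastforce
    qed
    show "?R \<subseteq> ?L"
    proof
      fix w assume "w \<in> ?R"
      then obtain n A B C where w: "(A, B, C) \<in> D n" "w \<in> space M" "a w \<in> A" "b w \<in> B" "c w \<in> C"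
        by fastforce
      then have "(a w, b w, c w) \<in> G"
        using D(1)[of n] by (auto simp: \<C>_def)
      then have "(a w, b w, c w) \<in> ?B \<inter> ?f -` {r<..}"
        using G(2) abcX[OF w(2)] by blast
      then show "w \<in> ?L" using w(2) by simp
    qed
  qed
  also have "\<dots> \<in> sets M"
  proof (intro sets.countable_UN image_subsetI)
    fix n
    show "(\<Union>(A, B, C)\<in>D n. {w \<in> space M. a w \<in> A \<and> b w \<in> B \<and> c w \<in> C}) \<in> sets M"
    proof (intro sets.finite_UN D(2))
      fix i assume "i \<in> D n"
      then obtain A B C where i: "i = (A, B, C)" "open A" "open B" "open C"
        using D(1)[of n] by (auto simp: \<C>_def)
      then have [measurable]: "A \<in> sets borel" "B \<in> sets borel" "C \<in> sets borel"
        by auto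
      show "(case i of (A, B, C) \<Rightarrow> {w \<in> space M. a w \<in> A \<and> b w \<in> B \<and> c w \<in> C}) \<in> sets M"
        unfolding i(1) by simp
    qed
  qed
  finally show "{w \<in> space M. r < F (a w) (b w) (c w)} \<in> sets M" .
qed

lemma space_path_borel [simp]: "space (path_borel a b) = cadlag_paths a b"
proof -
  interpret Metric_space "cadlag_paths a b" "skorokhod_dist a b"
    by (rule Metric_space_skorokhod)
  have "A \<subseteq> cadlag_paths a b" if "openin mtopology A" for A
    using openin_subset[OF that] by simp
  then show ?thesis
    unfolding path_borel_def by (subst space_measure_of) auto
qed

lemma sets_path_borel_openI:
  assumes "openin (Metric_space.mtopology (cadlag_paths a b) (skorokhod_dist a b)) A"
  shows "A \<in> sets (path_borel a b)"
proof -
  interpret Metric_space "cadlag_paths a b" "skorokhod_dist a b"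
    by (rule Metric_space_skorokhod)
  have "A' \<subseteq> cadlag_paths a b" if "openin mtopology A'" for A'
    using openin_subset[OF that] by simp
  then show ?thesis
    unfolding path_borel_def using assms by (subst sets_measure_of) (auto intro: sigma_sets.Basic)
qed

text \<open>
  The set is open: a path close to \<open>x\<close> takes the value \<open>x r\<close> at a time close to \<open>r\<close>, hence still inside
  the open time interval. Being different from \<open>i\<close> at one fixed time is not an open condition.
\<close>

lemma sets_leaving_path:
  assumes pq: "{p<..<q} \<subseteq> {a..b}"
  shows "{\<omega> \<in> cadlag_paths a b. \<exists>r\<in>{p<..<q}. \<omega> r \<noteq> i} \<in> sets (path_borel a b)" (is "?A \<in> _")
proof (rule sets_path_borel_openI)
  interpret Metric_space "cadlag_paths a b" "skorokhod_dist a b"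
    by (rule Metric_space_skorokhod)
  show "openin mtopology ?A"
    unfolding openin_mtopology
  proof (intro conjI allI impI)
    fix x assume "x \<in> ?A"
    then obtain r where x: "x \<in> cadlag_paths a b" "p < r" "r < q" "x r \<noteq> i" by auto
    have rab: "r \<in> {a..b}" using pq x by auto
    have "mball x (min 1 (min (r - p) (q - r))) \<subseteq> ?A"
    proof
      fix y assume "y \<in> mball x (min 1 (min (r - p) (q - r)))"
      then have y: "y \<in> cadlag_paths a b" "skorokhod_dist a b x y < min 1 (min (r - p) (q - r))"
        by (auto simp: in_mball)
      then obtain e l where e: "e < min 1 (min (r - p) (q - r))"
        "\<forall>t\<in>{a..b}. \<bar>l t - t\<bar> \<le> e \<and> of_bool (x t \<noteq> y (l t)) \<le> e"
        unfolding skorokhod_dist_less_iff by blast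
      then have "\<bar>l r - r\<bar> \<le> e" "of_bool (x r \<noteq> y (l r)) \<le> e" using rab by blast+
      then have "l r \<in> {p<..<q}" "x r = y (l r)"
        using e(1) by (auto simp: of_bool_def split: if_splits)
      then show "y \<in> ?A" using y(1) x(4) by auto
    qed
    then show "\<exists>r>0. mball x r \<subseteq> ?A"
      using x by (intro exI[of _ "min 1 (min (r - p) (q - r))"]) simp
  qed auto
qed

lemma sets_terminal_value:
  assumes ab: "a \<le> b"
  shows "{\<omega> \<in> cadlag_paths a b. \<omega> b = i} \<in> sets (path_borel a b)" (is "?A \<in> _")
proof (rule sets_path_borel_openI)
  interpret Metric_space "cadlag_paths a b" "skorokhod_dist a b"
    by (rule Metric_space_skorokhod)
  show "openin mtopology ?A"
    unfolding openin_mtopology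
  proof (intro conjI allI impI)
    fix x assume x: "x \<in> ?A"
    have "mball x 1 \<subseteq> ?A"
    proof
      fix y assume "y \<in> mball x 1"
      then have y: "y \<in> cadlag_paths a b" "skorokhod_dist a b x y < 1"
        by (auto simp: in_mball)
      then obtain e l where e: "e < 1" "l \<in> time_changes a b"
        "\<forall>t\<in>{a..b}. \<bar>l t - t\<bar> \<le> e \<and> of_bool (x t \<noteq> y (l t)) \<le> e"
        unfolding skorokhod_dist_less_iff by blast
      then have "of_bool (x b \<noteq> y b) \<le> e"
        using time_changes_right_end[OF e(2) ab] ab by (metis atLeastAtMost_iff order_refl)
      then show "y \<in> ?A" using y(1) x e(1) by (auto simp: of_bool_def split: if_splits)
    qed
    then show "\<exists>r>0. mball x r \<subseteq> ?A"
      by (intro exI[of _ 1]) simp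
  qed auto
qed

text \<open>
  Before the final time, a right-continuous path has value \<open>i\<close> at \<open>s\<close> if and only if it has value \<open>i\<close>
  throughout some interval \<open>{s<..<s + (b - s) / Suc n}\<close>; the final time is fixed by all time changes.
\<close>

lemma measurable_path_value:
  fixes s :: real
  assumes s: "s \<in> {a..b}"
  shows "(\<lambda>\<omega>. \<omega> s) \<in> path_borel a b \<rightarrow>\<^sub>M count_space (UNIV :: 's::finite set)"
proof (rule measurableI)
  fix A :: "'s set"
  have atom: "{\<omega> \<in> cadlag_paths a b. \<omega> s = i} \<in> sets (path_borel a b)" for i :: 's
  proof (cases "s = b")
    case True
    then show ?thesis using sets_terminal_value[of a b i] s by simp
  next
    case False
    then have sb: "a \<le> s" "s < b" using s by auto
    define L where "L n = {\<omega> \<in> cadlag_paths a b. \<exists>r\<in>{s<..<s + (b - s) / real (Suc n)}. \<omega> r \<noteq> i}" for n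
    have step: "0 < (b - s) / real (Suc n)" "(b - s) / real (Suc n) \<le> b - s" for n
      using sb frac_le[of "b - s" "b - s" 1 "real (Suc n)"] by auto
    have L: "L n \<in> sets (path_borel a b)" for n
      unfolding L_def using step(2)[of n] sb by (intro sets_leaving_path) auto
    have "{\<omega> \<in> cadlag_paths a b. \<omega> s = i} = (\<Union>n. cadlag_paths a b - L n)"
    proof (intro set_eqI iffI)
      fix \<omega> assume "\<omega> \<in> {\<omega> \<in> cadlag_paths a b. \<omega> s = i}"
      then have w: "\<omega> \<in> cadlag_paths a b" "\<omega> s = i" by auto
      obtain d where d: "0 < d" "\<And>r. s \<le> r \<Longrightarrow> r < s + d \<Longrightarrow> \<omega> r = \<omega> s"
        using cadlag_pathsD_right[OF w(1), of s] sb by auto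
      obtain n where "1 / real (Suc n) < d / (b - s)"
        using d sb by (metis diff_gt_0_iff_gt divide_pos_pos nat_approx_posE)
      then have "(b - s) / real (Suc n) < d"
        using sb by (simp add: field_simps del: of_nat_Suc)
      then have "\<omega> r = \<omega> s" if "r \<in> {s<..<s + (b - s) / real (Suc n)}" for r
        by (intro d(2)) (use that in simp_all)
      then have "\<omega> \<notin> L n"
        unfolding L_def using w(2) by blast
      then show "\<omega> \<in> (\<Union>n. cadlag_paths a b - L n)" using w by blast
    next
      fix \<omega> assume "\<omega> \<in> (\<Union>n. cadlag_paths a b - L n)"
      then obtain n where w: "\<omega> \<in> cadlag_paths a b" "\<omega> \<notin> L n" by blast
      obtain d where d: "0 < d" "\<And>r. s \<le> r \<Longrightarrow> r < s + d \<Longrightarrow> \<omega> r = \<omega> s"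
        using cadlag_pathsD_right[OF w(1), of s] sb by auto
      define m where "m = min d ((b - s) / real (Suc n))"
      have m: "0 < m" "m \<le> d" "m \<le> (b - s) / real (Suc n)"
        using d(1) step(1)[of n] by (auto simp: m_def)
      define r where "r = s + m / 2"
      have r: "s < r" "r < s + d" "r < s + (b - s) / real (Suc n)"
        using m by (simp_all only: r_def)
      have "\<omega> r = \<omega> s"
        by (rule d(2)) (use r in simp_all)
      moreover have "\<omega> r = i"
      proof (rule ccontr)
        assume "\<omega> r \<noteq> i"
        then have "\<omega> \<in> L n"
          unfolding L_def using w(1) r by (intro CollectI conjI bexI[of _ r]) simp_all
        with w(2) show False by contradiction
      qed
      ultimately have "\<omega> s = i" by simp
      then show "\<omega> \<in> {\<omega> \<in> cadlag_paths a b. \<omega> s = i}" using w by simp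
    qed
    also have "\<dots> \<in> sets (path_borel a b)"
      using L sets.top[of "path_borel a b"] by (intro sets.countable_UN image_subsetI sets.Diff) auto
    finally show ?thesis .
  qed
  have "(\<lambda>\<omega>. \<omega> s) -` A \<inter> space (path_borel a b) = (\<Union>i\<in>A. {\<omega> \<in> cadlag_paths a b. \<omega> s = i})"
    by auto
  then show "(\<lambda>\<omega>. \<omega> s) -` A \<inter> space (path_borel a b) \<in> sets (path_borel a b)"
    using atom by (simp add: sets.finite_UN)
qed simp

text \<open>
  The next point of the grid of mesh \<open>1 / Suc n\<close>, capped at the terminal time. It approximates times
  from the right, as right-continuity of paths and the preservation of stopping times both demand.
\<close>

definition grid_up :: "real \<Rightarrow> nat \<Rightarrow> real \<Rightarrow> real"
where
  "grid_up T n s = min T (of_int \<lceil>s * real (Suc n)\<rceil> / real (Suc n))"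

lemma grid_up_bounds:
  assumes "s \<le> T"
  shows "s \<le> grid_up T n s" "grid_up T n s \<le> T" "grid_up T n s \<le> s + 1 / real (Suc n)"
proof -
  have "s * real (Suc n) \<le> of_int \<lceil>s * real (Suc n)\<rceil>" "of_int \<lceil>s * real (Suc n)\<rceil> \<le> s * real (Suc n) + 1"
    by linarith+
  then have "s \<le> of_int \<lceil>s * real (Suc n)\<rceil> / real (Suc n)"
    "of_int \<lceil>s * real (Suc n)\<rceil> / real (Suc n) \<le> s + 1 / real (Suc n)"
    by (simp_all add: field_simps del: of_nat_Suc)
  then show "s \<le> grid_up T n s" "grid_up T n s \<le> T" "grid_up T n s \<le> s + 1 / real (Suc n)"
    using assms by (auto simp: grid_up_def simp del: of_nat_Suc)
qed

lemma grid_up_tendsto: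
  assumes "s \<le> T"
  shows "(\<lambda>n. grid_up T n s) \<longlonglongrightarrow> s"
proof (rule tendsto_sandwich[OF _ _ tendsto_const])
  show "(\<lambda>n. s + 1 / real (Suc n)) \<longlonglongrightarrow> s"
    using tendsto_add[OF tendsto_const LIMSEQ_inverse_real_of_nat, of s] by (simp add: inverse_eq_divide)
qed (use grid_up_bounds[OF assms] in auto)

lemma cadlag_path_grid_up:
  assumes w: "\<omega> \<in> cadlag_paths t0 T" and s: "s \<in> {t0..T}"
  shows "\<forall>\<^sub>F n in sequentially. \<omega> (grid_up T n s) = \<omega> s"
proof (cases "s = T")
  case True
  then have "grid_up T n s = s" for n
    using grid_up_bounds[of s T n] by simp
  then show ?thesis by simp
next
  case False
  then obtain d where d: "0 < d" "\<And>r. s \<le> r \<Longrightarrow> r < s + d \<Longrightarrow> \<omega> r = \<omega> s"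
    using cadlag_pathsD_right[OF w, of s] s by auto
  have "\<forall>\<^sub>F n in sequentially. grid_up T n s < s + d"
    using grid_up_tendsto[of s T] s d by (intro order_tendstoD) auto
  then show ?thesis
  proof eventually_elim
    case (elim n)
    show "\<omega> (grid_up T n s) = \<omega> s"
      by (rule d(2)) (use elim grid_up_bounds(1)[of s T n] s in simp_all)
  qed
qed

lemma finite_grid_up_image: "finite (grid_up T n ` {a..T})"
proof (rule finite_subset)
  let ?c = "real (Suc n)"
  show "grid_up T n ` {a..T} \<subseteq> (\<lambda>k. min T (of_int k / ?c)) ` {\<lceil>a * ?c\<rceil>..\<lceil>T * ?c\<rceil>}"
  proof (rule image_subsetI)
    fix s assume "s \<in> {a..T}"
    then have "\<lceil>s * ?c\<rceil> \<in> {\<lceil>a * ?c\<rceil>..\<lceil>T * ?c\<rceil>}"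
      by (auto intro!: ceiling_mono mult_right_mono simp del: of_nat_Suc)
    then show "grid_up T n s \<in> (\<lambda>k. min T (of_int k / ?c)) ` {\<lceil>a * ?c\<rceil>..\<lceil>T * ?c\<rceil>}"
      unfolding grid_up_def by (rule imageI)
  qed
qed simp

lemma measurable_path_value_joint:
  "(\<lambda>(s, \<omega>). \<omega> s) \<in> restrict_space borel {t0..T} \<Otimes>\<^sub>M path_borel t0 T \<rightarrow>\<^sub>M count_space (UNIV :: 's::finite set)"
    (is "_ \<in> ?N \<rightarrow>\<^sub>M _")
proof (rule measurableI)
  let ?e = "\<lambda>n x :: real \<times> (real \<Rightarrow> 's). snd x (grid_up T n (fst x))"
  have fst_borel: "fst \<in> ?N \<rightarrow>\<^sub>M borel"
    using measurable_fst[of "restrict_space borel {t0..T}" "path_borel t0 T"]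
    by (auto simp: measurable_restrict_space2_iff)
  have e: "?e n \<in> ?N \<rightarrow>\<^sub>M count_space UNIV" for n
    unfolding grid_up_def
  proof (rule measurable_compose_countable[where g = "\<lambda>x. \<lceil>fst x * real (Suc n)\<rceil>"
        and f = "\<lambda>k x. snd x (min T (of_int k / real (Suc n)))"])
    show "(\<lambda>x. \<lceil>fst x * real (Suc n)\<rceil>) \<in> ?N \<rightarrow>\<^sub>M count_space UNIV"
      using fst_borel by measurable
    fix k :: int
    let ?s = "min T (of_int k / real (Suc n))"
    show "(\<lambda>x. snd x ?s) \<in> ?N \<rightarrow>\<^sub>M count_space UNIV"
    proof (cases "t0 \<le> ?s")
      case True
      then show ?thesis
        by (intro measurable_compose[OF measurable_snd measurable_path_value]) auto
    next
      case False
      then have "snd x ?s = undefined" if "x \<in> space ?N" for x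
        using that by (auto simp: space_pair_measure cadlag_paths_def extensional_def)
      then show ?thesis by (simp cong: measurable_cong)
    qed
  qed
  fix A :: "'s set"
  have "(\<lambda>(s, \<omega>). \<omega> s) -` A \<inter> space ?N = {x \<in> space ?N. \<exists>m. \<forall>n. m \<le> n \<longrightarrow> ?e n x \<in> A}"
  proof -
    have iff: "snd x (fst x) \<in> A \<longleftrightarrow> (\<exists>m. \<forall>n. m \<le> n \<longrightarrow> ?e n x \<in> A)" if "x \<in> space ?N" for x
    proof -
      have "\<forall>\<^sub>F n in sequentially. ?e n x = snd x (fst x)"
        using that by (intro cadlag_path_grid_up[of _ t0]) (auto simp: space_pair_measure space_restrict_space)
      then obtain M where M: "\<And>n. M \<le> n \<Longrightarrow> ?e n x = snd x (fst x)"
        by (auto simp: eventually_sequentially)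
      show ?thesis
      proof
        assume "snd x (fst x) \<in> A"
        then show "\<exists>m. \<forall>n. m \<le> n \<longrightarrow> ?e n x \<in> A"
          using M by (intro exI[of _ M]) simp
      next
        assume "\<exists>m. \<forall>n. m \<le> n \<longrightarrow> ?e n x \<in> A"
        then obtain m where "\<And>n. m \<le> n \<Longrightarrow> ?e n x \<in> A" by blast
        then have "?e (max m M) x \<in> A" by simp
        then show "snd x (fst x) \<in> A" using M[of "max m M"] by simp
      qed
    qed
    show ?thesis
    proof (rule set_eqI)
      fix x
      show "x \<in> (\<lambda>(s, \<omega>). \<omega> s) -` A \<inter> space ?N \<longleftrightarrow> x \<in> {x \<in> space ?N. \<exists>m. \<forall>n. m \<le> n \<longrightarrow> ?e n x \<in> A}"
        using iff[of x] by (cases "x \<in> space ?N") (simp_all add: split_beta)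
    qed
  qed
  also have "\<dots> \<in> sets ?N"
  proof -
    have "{x \<in> space ?N. ?e n x \<in> A} \<in> sets ?N" for n
      using measurable_sets[OF e, of A n] by (simp add: vimage_def Int_def conj_commute)
    then show ?thesis
      by (intro sets.sets_Collect_countable_Ex sets.sets_Collect_countable_All
          sets.sets_Collect_imp sets.sets_Collect_const)
  qed
  finally show "(\<lambda>(s, \<omega>). \<omega> s) -` A \<inter> space ?N \<in> sets ?N" .
qed simp

text \<open>
  The finitely many values of the state are treated one at a time, since \<open>c\<close> is only measurable in time
  for each fixed state.
\<close>

lemma measurable_controlled_integrand:
  fixes F :: "'s::finite \<Rightarrow> real \<Rightarrow> 'u::topological_space \<Rightarrow> 'v::topological_space \<Rightarrow> real"
  assumes t0: "t0 \<in> {0..T}" and cpt: "compact U" "compact V"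
    and cont: "\<And>i. continuous_on ({0..T} \<times> U \<times> V) (\<lambda>(t, u, v). F i t u v)"
    and \<alpha>: "\<alpha> \<in> memory_strategies T t0 U" and c: "c \<in> feedback_strategies T V"
    and P: "sets P = sets (path_borel t0 T)" "subalgebra P (path_filtration T t0 T)"
  shows "(\<lambda>(s, \<omega>). F (\<omega> s) s (\<alpha> s \<omega>) (c s (\<omega> s))) \<in> borel_measurable (restrict_space borel {t0..T} \<Otimes>\<^sub>M P)"
    (is "_ \<in> borel_measurable ?N")
proof -
  have time: "fst \<in> ?N \<rightarrow>\<^sub>M restrict_space borel {0..T}"
    using measurable_fst[of "restrict_space borel {t0..T}" P] t0
    by (auto simp: measurable_restrict_space2_iff space_pair_measure space_restrict_space)
  have state: "(\<lambda>x. snd x (fst x)) \<in> ?N \<rightarrow>\<^sub>M count_space UNIV"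
    using measurable_path_value_joint[of t0 T]
    unfolding measurable_cong_sets[OF sets_pair_measure_cong[OF refl P(1)] refl] split_beta .
  have past: "snd \<in> ?N \<rightarrow>\<^sub>M path_filtration T t0 T"
    by (rule measurable_compose[OF measurable_snd, of "\<lambda>x. x"])
      (auto intro: measurable_from_subalg[OF P(2)])
  have "(\<lambda>x. \<alpha> (fst x) (snd x)) \<in> restrict_space borel {t0..T} \<Otimes>\<^sub>M path_filtration T t0 T \<rightarrow>\<^sub>M restrict_space borel U"
    using \<alpha> t0 unfolding memory_strategies_def case_prod_beta' by simp
  from measurable_compose[OF measurable_Pair[OF measurable_fst past] this]
  have control: "(\<lambda>x. \<alpha> (fst x) (snd x)) \<in> ?N \<rightarrow>\<^sub>M restrict_space borel U"
    by simp
  have "(\<lambda>x. F (snd x (fst x)) (fst x) (\<alpha> (fst x) (snd x)) (c (fst x) (snd x (fst x)))) \<in> borel_measurable ?N"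
  proof (rule measurable_compose_countable[OF _ state, where
        f = "\<lambda>i x. F i (fst x) (\<alpha> (fst x) (snd x)) (c (fst x) i)"])
    fix i
    have "(\<lambda>t. c t i) \<in> restrict_space borel {0..T} \<rightarrow>\<^sub>M restrict_space borel V"
      using c by (simp add: feedback_strategies_def)
    then have "(\<lambda>x. c (fst x) i) \<in> ?N \<rightarrow>\<^sub>M restrict_space borel V"
      by (rule measurable_compose[OF time])
    then show "(\<lambda>x. F i (fst x) (\<alpha> (fst x) (snd x)) (c (fst x) i)) \<in> borel_measurable ?N"
      by (intro borel_measurable_continuous_compact_box[OF _ cpt cont[of i] time control]) simp_all
  qed
  then show ?thesis
    by (simp add: split_beta)
qed

lemma continuous_compact_box_bounded:
  fixes F :: "'s::finite \<Rightarrow> real \<Rightarrow> 'u::topological_space \<Rightarrow> 'v::topological_space \<Rightarrow> real"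
  assumes cpt: "compact U" "compact V"
    and cont: "\<And>i. continuous_on ({0..T} \<times> U \<times> V) (\<lambda>(t, u, v). F i t u v)"
  obtains B where "0 \<le> B" "\<And>i t u v. t \<in> {0..T} \<Longrightarrow> u \<in> U \<Longrightarrow> v \<in> V \<Longrightarrow> \<bar>F i t u v\<bar> \<le> B"
proof -
  have "\<exists>B. \<forall>z\<in>{0..T} \<times> U \<times> V. \<bar>case z of (t, u, v) \<Rightarrow> F i t u v\<bar> \<le> B" for i
  proof -
    have "compact ((\<lambda>(t, u, v). F i t u v) ` ({0..T} \<times> U \<times> V))"
      by (intro compact_continuous_image[OF cont] compact_Times cpt) simp
    then show ?thesis
      by (auto dest!: compact_imp_bounded simp: bounded_iff)
  qed
  then obtain B where B: "\<And>i z. z \<in> {0..T} \<times> U \<times> V \<Longrightarrow> \<bar>case z of (t, u, v) \<Rightarrow> F i t u v\<bar> \<le> B i"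
    by metis
  show thesis
  proof (rule that[of "\<Sum>i\<in>UNIV. \<bar>B i\<bar>"])
    fix i t u v assume "t \<in> {0..T}" "u \<in> U" "v \<in> V"
    then have "\<bar>F i t u v\<bar> \<le> B i" using B[of "(t, u, v)" i] by simp
    also have "\<dots> \<le> \<bar>B i\<bar>" by simp
    also have "\<dots> \<le> (\<Sum>i\<in>UNIV. \<bar>B i\<bar>)"
      by (rule member_le_sum) auto
    finally show "\<bar>F i t u v\<bar> \<le> (\<Sum>i\<in>UNIV. \<bar>B i\<bar>)" .
  qed (simp add: sum_nonneg)
qed

section \<open>Running integrals\<close>

text \<open>
  The time variable of \<open>k\<close> is clamped to \<open>{a..b}\<close> in order to apply Fubini measurability on the whole
  line, and Lebesgue integrals of the resulting Borel functions are integrals over \<open>lborel\<close>.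
\<close>

lemma running_integral:
  fixes k :: "real \<Rightarrow> 'a \<Rightarrow> real"
  assumes k: "(\<lambda>(s, \<omega>). k s \<omega>) \<in> borel_measurable (restrict_space borel {a..b} \<Otimes>\<^sub>M P)"
    and B: "\<forall>s\<in>{a..b}. \<forall>\<omega>\<in>space P. \<bar>k s \<omega>\<bar> \<le> B"
  shows "t \<in> {a..b} \<Longrightarrow> \<omega> \<in> space P \<Longrightarrow> set_integrable lebesgue {a..t} (\<lambda>s. k s \<omega>)"
    and "t \<in> {a..b} \<Longrightarrow> (\<lambda>\<omega>. LINT s:{a..t}|lebesgue. k s \<omega>) \<in> borel_measurable P"
    and "t \<in> {a..b} \<Longrightarrow> \<omega> \<in> space P \<Longrightarrow> \<bar>LINT s:{a..t}|lebesgue. k s \<omega>\<bar> \<le> B * (b - a)"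
    and "\<omega> \<in> space P \<Longrightarrow> t \<in> {a..b} \<Longrightarrow> (\<And>n. \<sigma> n \<in> {t..b}) \<Longrightarrow> \<sigma> \<longlonglongrightarrow> t \<Longrightarrow>
      (\<lambda>n. LINT s:{a..\<sigma> n}|lebesgue. k s \<omega>) \<longlonglongrightarrow> (LINT s:{a..t}|lebesgue. k s \<omega>)"
proof -
  define c where "c s = max a (min b s)" for s
  define K where "K t \<omega> s = indicator {a..t} s * k (c s) \<omega>" for t \<omega> s
  have Keq: "indicator {a..t} s *\<^sub>R k s \<omega> = K t \<omega> s" if "t \<in> {a..b}" for t \<omega> s
    using that by (auto simp: K_def c_def indicator_def)
  have joint: "(\<lambda>(\<omega>, s). K t \<omega> s) \<in> borel_measurable (P \<Otimes>\<^sub>M lborel)" if t: "t \<in> {a..b}" for t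
  proof -
    have c_in: "c s \<in> {a..b}" for s
      using t by (auto simp: c_def)
    have "(\<lambda>(\<omega>, s). (c s, \<omega>)) \<in> P \<Otimes>\<^sub>M lborel \<rightarrow>\<^sub>M restrict_space borel {a..b} \<Otimes>\<^sub>M P"
      unfolding split_beta
    proof (rule measurable_Pair)
      show "(\<lambda>x. c (snd x)) \<in> P \<Otimes>\<^sub>M lborel \<rightarrow>\<^sub>M restrict_space borel {a..b}"
        using c_in by (intro measurable_restrict_space2) (auto simp: c_def)
    qed simp
    from measurable_compose[OF this k]
    have [measurable]: "(\<lambda>x. k (c (snd x)) (fst x)) \<in> borel_measurable (P \<Otimes>\<^sub>M lborel)"
      by (simp add: split_beta)
    show ?thesis
      unfolding K_def split_beta by measurable
  qed
  have meas: "K t \<omega> \<in> borel_measurable lborel" if "t \<in> {a..b}" "\<omega> \<in> space P" for t \<omega>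
    using measurable_compose[OF measurable_Pair1'[OF that(2)] joint[OF that(1)]] by simp
  have bd: "norm (K t \<omega> s) \<le> B * indicator {a..b} s" if "t \<in> {a..b}" "\<omega> \<in> space P" for t \<omega> s
    using that B[rule_format, of s \<omega>] by (auto simp: K_def c_def indicator_def)
  have w: "integrable lborel (\<lambda>s. B * indicator {a..b} s)"
    by (intro integrable_mult_right integrable_real_indicator) (auto simp: emeasure_lborel_Icc_eq)
  have int: "integrable lborel (K t \<omega>)" if "t \<in> {a..b}" "\<omega> \<in> space P" for t \<omega>
    by (rule Bochner_Integration.integrable_bound[OF w meas[OF that]])
      (use bd[OF that] in \<open>auto intro!: AE_I2 intro: order_trans[OF _ abs_ge_self]\<close>)
  have val: "(LINT s:{a..t}|lebesgue. k s \<omega>) = (LINT s|lborel. K t \<omega> s)"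
    if "t \<in> {a..b}" "\<omega> \<in> space P" for t \<omega>
    unfolding set_lebesgue_integral_def Keq[OF that(1)] using meas[OF that] by (rule integral_completion)
  show "set_integrable lebesgue {a..t} (\<lambda>s. k s \<omega>)" if "t \<in> {a..b}" "\<omega> \<in> space P"
    unfolding set_integrable_def Keq[OF that(1)] using int[OF that] meas[OF that] by (simp add: integrable_completion)
  show "(\<lambda>\<omega>. LINT s:{a..t}|lebesgue. k s \<omega>) \<in> borel_measurable P" if "t \<in> {a..b}"
  proof -
    have "(\<lambda>\<omega>. LINT s|lborel. K t \<omega> s) \<in> borel_measurable P"
      using joint[OF that] by (rule lborel.borel_measurable_lebesgue_integral)
    then show ?thesis
      by (rule measurable_cong[THEN iffD1, rotated]) (simp add: val[OF that])
  qed
  show "\<bar>LINT s:{a..t}|lebesgue. k s \<omega>\<bar> \<le> B * (b - a)" if "t \<in> {a..b}" "\<omega> \<in> space P"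
  proof -
    have "norm (LINT s|lborel. K t \<omega> s) \<le> (LINT s|lborel. B * indicator {a..b} s)"
      by (rule Bochner_Integration.integral_norm_bound_integral[OF int[OF that] w]) (use bd[OF that] in simp)
    then show ?thesis
      using that by (simp add: val[OF that])
  qed
  show "(\<lambda>n. LINT s:{a..\<sigma> n}|lebesgue. k s \<omega>) \<longlonglongrightarrow> (LINT s:{a..t}|lebesgue. k s \<omega>)"
    if w': "\<omega> \<in> space P" and t: "t \<in> {a..b}" and \<sigma>: "\<And>n. \<sigma> n \<in> {t..b}" "\<sigma> \<longlonglongrightarrow> t"
  proof -
    have \<sigma>_in: "\<sigma> n \<in> {a..b}" for n using \<sigma>(1)[of n] t by auto
    have "(\<lambda>n. LINT s|lborel. K (\<sigma> n) \<omega> s) \<longlonglongrightarrow> (LINT s|lborel. K t \<omega> s)"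
    proof (rule integral_dominated_convergence[OF _ _ w])
      show "AE s in lborel. (\<lambda>n. K (\<sigma> n) \<omega> s) \<longlonglongrightarrow> K t \<omega> s"
      proof (rule AE_I2)
        fix s :: real
        show "(\<lambda>n. K (\<sigma> n) \<omega> s) \<longlonglongrightarrow> K t \<omega> s"
        proof (cases "s \<le> t")
          case True
          then have "K (\<sigma> n) \<omega> s = K t \<omega> s" for n
            using \<sigma>(1)[of n] by (auto simp: K_def indicator_def)
          then show ?thesis by simp
        next
          case False
          then have "\<forall>\<^sub>F n in sequentially. \<sigma> n < s"
            using \<sigma>(2) by (intro order_tendstoD) auto
          then have "\<forall>\<^sub>F n in sequentially. K (\<sigma> n) \<omega> s = K t \<omega> s"
            by eventually_elim (use False in \<open>auto simp: K_def indicator_def\<close>)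
          then show ?thesis by (rule tendsto_eventually)
        qed
      qed
    qed (use meas w' t \<sigma>_in bd in auto)
    then show ?thesis
      unfolding val[OF t w'] val[OF \<sigma>_in w'] .
  qed
qed

lemma set_integrable_along_path:
  fixes f :: "real \<Rightarrow> 's::finite \<Rightarrow> real"
  assumes f: "\<And>i. set_integrable lebesgue {t0..T} (\<lambda>s. f s i)" and w: "\<omega> \<in> cadlag_paths t0 T" and t: "t \<in> {t0..T}"
  shows "set_integrable lebesgue {t0..t} (\<lambda>s. f s (\<omega> s))"
proof -
  have "(\<lambda>s. \<omega> s) \<in> restrict_space borel {t0..T} \<rightarrow>\<^sub>M count_space UNIV"
    using measurable_compose[OF measurable_Pair2'[of \<omega> "path_borel t0 T"] measurable_path_value_joint] w by simp
  then have level: "\<omega> -` {i} \<inter> {t0..T} \<in> sets borel" for i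
    using measurable_sets[of \<omega> "restrict_space borel {t0..T}" "count_space UNIV" "{i}"]
    by (auto simp: sets_restrict_space space_restrict_space)
  have "(\<omega> -` {i} \<inter> {t0..T}) \<inter> {t0..t} \<in> sets borel" for i
    by (rule sets.Int[OF level]) simp
  then have "(\<omega> -` {i} \<inter> {t0..T}) \<inter> {t0..t} \<in> sets lebesgue" for i
    by simp
  moreover have "(\<omega> -` {i} \<inter> {t0..T}) \<inter> {t0..t} = {s \<in> {t0..t}. \<omega> s = i}" for i
    using t by auto
  ultimately have meas: "{s \<in> {t0..t}. \<omega> s = i} \<in> sets lebesgue" for i
    by simp
  have "set_integrable lebesgue {s \<in> {t0..t}. \<omega> s = i} (\<lambda>s. f s (\<omega> s))" for i
  proof -
    have "set_integrable lebesgue {s \<in> {t0..t}. \<omega> s = i} (\<lambda>s. f s i)"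
      by (rule set_integrable_subset[OF f meas]) (use t in auto)
    then show ?thesis
      by (rule set_integrable_cong[THEN iffD1, rotated -1]) auto
  qed
  then have "set_integrable lebesgue (\<Union>i\<in>UNIV. {s \<in> {t0..t}. \<omega> s = i}) (\<lambda>s. f s (\<omega> s))"
    using meas by (intro set_integrable_UN) auto
  moreover have "(\<Union>i\<in>UNIV. {s \<in> {t0..t}. \<omega> s = i}) = {t0..t}"
    by auto
  ultimately show ?thesis by simp
qed

section \<open>Optional stopping on a grid\<close>

lemma martingale_on_stopped_finite:
  assumes P: "prob_space P" and mart: "martingale_on P F {a..b} X" and ab: "a \<le> b"
    and \<sigma>: "stopping_time F \<sigma>" "\<And>\<omega>. \<omega> \<in> space P \<Longrightarrow> \<sigma> \<omega> \<in> A" and A: "finite A" "A \<subseteq> {a..b}"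
  shows "integrable P (\<lambda>\<omega>. X (\<sigma> \<omega>) \<omega>)" and "(LINT \<omega>|P. X (\<sigma> \<omega>) \<omega>) = (LINT \<omega>|P. X b \<omega>)"
proof -
  interpret prob_space P by (rule P)
  have filt: "filtration (space P) F" and sub: "subalgebra P (F t)" for t
    using mart by (auto simp: martingale_on_def)
  have X: "integrable P (X t)" if "t \<in> {a..b}" for t
    using mart that by (auto simp: martingale_on_def)
  define B where "B t = {\<omega> \<in> space P. \<sigma> \<omega> = t}" for t
  have BF: "B t \<in> sets (F t)" for t
    using filtration.stopping_time_eq_const[OF filt \<sigma>(1), of t] filtration.space_F[OF filt, of t]
    by (simp add: B_def Measurable.pred_def)
  then have B: "B t \<in> sets P" for t
    using sub[of t] by (auto simp: subalgebra_def)
  have int: "integrable P (\<lambda>\<omega>. indicator (B t) \<omega> * X s \<omega>)" if "s \<in> {a..b}" for s t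
    using integrable_mult_indicator[OF B X[OF that]] by simp
  have eq: "(LINT \<omega>|P. indicator (B t) \<omega> * X t \<omega>) = (LINT \<omega>|P. indicator (B t) \<omega> * X b \<omega>)"
    if t: "t \<in> {a..b}" for t
  proof -
    interpret finite_measure_subalgebra P "F t"
      by unfold_locales (rule sub)
    have "(LINT \<omega>:B t|P. X b \<omega>) = (LINT \<omega>:B t|P. real_cond_exp P (F t) (X b) \<omega>)"
      using X[of b] ab BF by (intro real_cond_exp_intA) auto
    also have "\<dots> = (LINT \<omega>:B t|P. X t \<omega>)"
    proof (rule set_lebesgue_integral_cong_AE[OF B])
      have "AE \<omega> in P. real_cond_exp P (F t) (X b) \<omega> = X t \<omega>"
        using mart t ab by (auto simp: martingale_on_def)
      then show "AE \<omega>\<in>B t in P. real_cond_exp P (F t) (X b) \<omega> = X t \<omega>"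
        by eventually_elim simp
    qed (use X[OF t] in auto)
    finally show ?thesis
      by (simp add: set_lebesgue_integral_def)
  qed
  have at_stop: "Y (\<sigma> \<omega>) \<omega> = (\<Sum>t\<in>A. indicator (B t) \<omega> * Y t \<omega>)" if "\<omega> \<in> space P"
    for Y :: "real \<Rightarrow> _ \<Rightarrow> real" and \<omega>
  proof -
    have "(\<Sum>t\<in>A. indicator (B t) \<omega> * Y t \<omega>) = (\<Sum>t\<in>A. if t = \<sigma> \<omega> then Y t \<omega> else 0)"
      using that by (intro sum.cong refl) (auto simp: B_def indicator_def)
    then show ?thesis using A(1) \<sigma>(2)[OF that] by simp
  qed
  have "integrable P (\<lambda>\<omega>. \<Sum>t\<in>A. indicator (B t) \<omega> * X t \<omega>)"
    using int A by (intro Bochner_Integration.integrable_sum) auto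
  then show "integrable P (\<lambda>\<omega>. X (\<sigma> \<omega>) \<omega>)"
    by (rule Bochner_Integration.integrable_cong[THEN iffD1, OF refl, rotated]) (simp add: at_stop[of _ X])
  have "(LINT \<omega>|P. X (\<sigma> \<omega>) \<omega>) = (LINT \<omega>|P. (\<Sum>t\<in>A. indicator (B t) \<omega> * X t \<omega>))"
    by (intro Bochner_Integration.integral_cong refl) (simp add: at_stop[of _ X])
  also have "\<dots> = (\<Sum>t\<in>A. LINT \<omega>|P. indicator (B t) \<omega> * X t \<omega>)"
    using int A by (intro Bochner_Integration.integral_sum) auto
  also have "\<dots> = (\<Sum>t\<in>A. LINT \<omega>|P. indicator (B t) \<omega> * X b \<omega>)"
    using eq A by (intro sum.cong refl) auto
  also have "\<dots> = (LINT \<omega>|P. (\<Sum>t\<in>A. indicator (B t) \<omega> * X b \<omega>))"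
    using int[of b] ab by (intro Bochner_Integration.integral_sum[symmetric]) auto
  also have "\<dots> = (LINT \<omega>|P. X b \<omega>)"
    by (intro Bochner_Integration.integral_cong refl) (simp add: at_stop[of _ "\<lambda>_. X b"])
  finally show "(LINT \<omega>|P. X (\<sigma> \<omega>) \<omega>) = (LINT \<omega>|P. X b \<omega>)" .
qed

text \<open>
  Rounding up to a grid depends at time \<open>t\<close> only on whether the original time has passed the last grid
  point not after \<open>t\<close>.
\<close>

lemma stopping_time_grid_up:
  assumes "stopping_time F \<tau>" "filtration \<Omega> F"
  shows "stopping_time F (\<lambda>\<omega>. grid_up T n (\<tau> \<omega>))"
proof
  fix t
  interpret filtration \<Omega> F by (rule assms(2))
  show "Measurable.pred (F t) (\<lambda>\<omega>. grid_up T n (\<tau> \<omega>) \<le> t)"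
  proof (cases "T \<le> t")
    case True
    then show ?thesis by (simp add: grid_up_def min_le_iff_disj)
  next
    case False
    let ?u = "of_int \<lfloor>t * real (Suc n)\<rfloor> / real (Suc n)"
    have "grid_up T n s \<le> t \<longleftrightarrow> s \<le> ?u" for s
    proof -
      have "grid_up T n s \<le> t \<longleftrightarrow> of_int \<lceil>s * real (Suc n)\<rceil> \<le> t * real (Suc n)"
        using False by (simp add: grid_up_def min_le_iff_disj pos_divide_le_eq del: of_nat_Suc)
      also have "\<dots> \<longleftrightarrow> s * real (Suc n) \<le> of_int \<lfloor>t * real (Suc n)\<rfloor>"
        by (simp add: le_floor_iff[symmetric] ceiling_le_iff[symmetric] del: of_nat_Suc)
      also have "\<dots> \<longleftrightarrow> s \<le> ?u"
        by (simp add: pos_le_divide_eq del: of_nat_Suc)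
      finally show ?thesis .
    qed
    moreover have "?u \<le> t"
      by (simp add: pos_divide_le_eq del: of_nat_Suc)
    ultimately show ?thesis
      using stopping_time_le_const[OF assms(1), of ?u t] by simp
  qed
qed

section \<open>The guaranteed payoff\<close>

lemma SUP_INF_le_arg_max:
  fixes f :: "'u \<Rightarrow> 'v \<Rightarrow> real"
  assumes "is_arg_max (\<lambda>v. INF u\<in>U. f u v) (\<lambda>v. v \<in> V) v" "u \<in> U" "bdd_below ((\<lambda>u. f u v) ` U)"
  shows "(SUP v\<in>V. INF u\<in>U. f u v) \<le> f u v"
proof -
  have "(SUP v\<in>V. INF u\<in>U. f u v) \<le> (INF u\<in>U. f u v)"
    using assms(1) by (intro cSUP_least) (auto simp: is_arg_max_def not_less)
  also have "\<dots> \<le> f u v"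
    using assms(2,3) by (intro cINF_lower)
  finally show ?thesis .
qed

theorem mainTheorem5:
  fixes T :: real
    and U :: "'u::topological_space set"
    and V :: "'v::topological_space set"
    and Q :: "real \<Rightarrow> 'u \<Rightarrow> 'v \<Rightarrow> 's::finite \<Rightarrow> 's \<Rightarrow> real"
    and g :: "real \<Rightarrow> 's \<Rightarrow> real"
    and h :: "real \<Rightarrow> 's \<Rightarrow> 'u \<Rightarrow> 'v \<Rightarrow> real"
    and \<phi> :: "real \<Rightarrow> 's \<Rightarrow> real"
    and v\<phi> :: "real \<Rightarrow> 's \<Rightarrow> 'v"
    and t0 :: real
    and i0 :: 's
    and \<alpha> :: "real \<Rightarrow> (real \<Rightarrow> 's) \<Rightarrow> 'u"
    and \<tau> :: "(real \<Rightarrow> 's) \<Rightarrow> real"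
    and P :: "(real \<Rightarrow> 's) measure"
  assumes T_pos: "0 < T"
    and Kolmogorov: "\<And>t u v. t \<in> {0..T} \<Longrightarrow> u \<in> U \<Longrightarrow> v \<in> V \<Longrightarrow> Kolmogorov_matrix (Q t u v)"
    and compact_controls: "compact U" "compact V"
    and continuous_Q: "\<And>i j. continuous_on ({0..T} \<times> U \<times> V) (\<lambda>(t, u, v). Q t u v i j)"
    and continuous_g: "\<And>i. continuous_on {0..T} (\<lambda>t. g t i)"
    and continuous_h: "\<And>i. continuous_on ({0..T} \<times> U \<times> V) (\<lambda>(t, u, v). h t i u v)"
    and Lipschitz_g: "\<exists>L. \<forall>i. L-lipschitz_on {0..T} (\<lambda>t. g t i)"
    and Isaacs: "\<And>t i w. t \<in> {0..T} \<Longrightarrow>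
      (INF u\<in>U. SUP v\<in>V. pre_Hamiltonian Q h i t w u v) =
      (SUP v\<in>V. INF u\<in>U. pre_Hamiltonian Q h i t w u v)"
    and AC_\<phi>: "\<phi> \<in> AC T"
    and Z2: "\<And>i t. t \<in> {0..T} \<Longrightarrow> \<phi> t i \<le> g t i"
    and Z4: "\<And>i t D. t \<in> {0..T} \<Longrightarrow>
      ((\<lambda>s. \<phi> s i) has_real_derivative D) (at t within {0..T}) \<Longrightarrow>
      D \<ge> - Hamiltonian U V Q h i t (\<phi> t)"
    and feedback: "v\<phi> \<in> feedback_strategies T V"
    and argmax: "\<And>t i. t \<in> {0..T} \<Longrightarrow>
      is_arg_max (\<lambda>v. INF u\<in>U. pre_Hamiltonian Q h i t (\<phi> t) u v) (\<lambda>v. v \<in> V) (v\<phi> t i)"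
    and t0: "t0 \<in> {0..T}"
    and \<alpha>: "\<alpha> \<in> memory_strategies T t0 U"
    and \<tau>: "\<tau> \<in> stopping_times T t0"
    and P: "generated_probability T Q t0 i0 \<alpha> (feedback_to_memory v\<phi>) P"
  shows "(LINT \<omega>|P. payoff g h t0 \<alpha> (feedback_to_memory v\<phi>) (\<tau> \<omega>) \<omega>) \<ge> \<phi> t0 i0"
proof -
  let ?F = "path_filtration T t0 :: real \<Rightarrow> (real \<Rightarrow> 's) measure"
  let ?G = "payoff g h t0 \<alpha> (feedback_to_memory v\<phi>)"
  let ?X = "Dynkin_process T Q t0 \<alpha> (feedback_to_memory v\<phi>) \<phi>"
  let ?h = "\<lambda>s \<omega>. h s (\<omega> s) (\<alpha> s \<omega>) (v\<phi> s (\<omega> s))"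
  let ?L = "\<lambda>s \<omega>. \<Sum>j\<in>UNIV. Q s (\<alpha> s \<omega>) (v\<phi> s (\<omega> s)) (\<omega> s) j * \<phi> s j"
  have t0T: "t0 \<le> T" "0 \<le> t0" using t0 by auto
  have prob: "prob_space P" and setsP: "sets P = sets (path_borel t0 T)"
    and start: "measure P {\<omega> \<in> space P. \<omega> t0 = i0} = 1"
    and mart: "martingale_on P ?F {t0..T} ?X"
    using P AC_\<phi> by (auto simp: generated_probability_def)
  interpret prob_space P by (rule prob)
  have spaceP: "space P = cadlag_paths t0 T"
    using sets_eq_imp_space_eq[OF setsP] by simp
  have filt: "filtration (space P) ?F" and sub: "subalgebra P (?F t)" for t
    using mart by (auto simp: martingale_on_def)

  have cont_\<phi>: "continuous_on {0..T} (\<lambda>t. \<phi> t j)" for j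
    using AC_\<phi> by (intro abs_continuous_on_imp_continuous_on) (simp add: AC_def)
  have cont_L: "continuous_on ({0..T} \<times> U \<times> V) (\<lambda>(t, u, v). \<Sum>j\<in>UNIV. Q t u v i j * \<phi> t j)" for i
  proof -
    have "continuous_on ({0..T} \<times> U \<times> V) (\<lambda>x. \<phi> (fst x) j)" for j
      by (rule continuous_on_compose2[OF cont_\<phi>]) (auto intro: continuous_on_fst)
    then show ?thesis
      using continuous_Q unfolding split_beta by (intro continuous_on_sum continuous_on_mult)
  qed
  have cont_H: "continuous_on ({0..T} \<times> U \<times> V) (\<lambda>(t, u, v). pre_Hamiltonian Q h i t (\<phi> t) u v)" for i
    using cont_L[of i] continuous_h[of i] unfolding pre_Hamiltonian_def split_beta by (intro continuous_on_add)
  obtain Bh where Bh: "0 \<le> Bh" "\<And>i t u v. t \<in> {0..T} \<Longrightarrow> u \<in> U \<Longrightarrow> v \<in> V \<Longrightarrow> \<bar>h t i u v\<bar> \<le> Bh"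
    using continuous_compact_box_bounded[where F = "\<lambda>i t u v. h t i u v", OF compact_controls continuous_h]
    by metis
  obtain BL where BL: "0 \<le> BL"
    "\<And>i t u v. t \<in> {0..T} \<Longrightarrow> u \<in> U \<Longrightarrow> v \<in> V \<Longrightarrow> \<bar>\<Sum>j\<in>UNIV. Q t u v i j * \<phi> t j\<bar> \<le> BL"
    using continuous_compact_box_bounded[where F = "\<lambda>i t u v. \<Sum>j\<in>UNIV. Q t u v i j * \<phi> t j", OF compact_controls cont_L]
    by metis
  obtain BH where BH: "0 \<le> BH"
    "\<And>i t u v. t \<in> {0..T} \<Longrightarrow> u \<in> U \<Longrightarrow> v \<in> V \<Longrightarrow> \<bar>pre_Hamiltonian Q h i t (\<phi> t) u v\<bar> \<le> BH"
    using continuous_compact_box_bounded[where F = "\<lambda>i t u v. pre_Hamiltonian Q h i t (\<phi> t) u v", OF compact_controls cont_H]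
    by metis
  obtain Bg where Bg: "\<And>i t. t \<in> {0..T} \<Longrightarrow> \<bar>g t i\<bar> \<le> Bg"
  proof -
    \<comment> \<open>\<open>g\<close> is read as a function of dummy controls\<close>
    have "continuous_on ({0..T} \<times> {0::real} \<times> {0::real}) (\<lambda>(t, u, v). g t i)" for i
      unfolding split_beta
      by (rule continuous_on_compose2[OF continuous_g]) (auto intro: continuous_on_fst)
    then obtain B where "\<And>i t u v. t \<in> {0..T} \<Longrightarrow> u \<in> {0::real} \<Longrightarrow> v \<in> {0::real} \<Longrightarrow> \<bar>g t i\<bar> \<le> B"
      by (rule continuous_compact_box_bounded[rotated 2, where F = "\<lambda>i t _ _. g t i"]) auto
    then show thesis by (intro that) auto
  qed

  have \<alpha>_in: "\<alpha> s \<omega> \<in> U" if "s \<in> {t0..T}" "\<omega> \<in> space P" for s \<omega>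
  proof -
    have "(\<lambda>(s, \<omega>). \<alpha> s \<omega>) \<in> restrict_space borel {t0..T} \<Otimes>\<^sub>M ?F T \<rightarrow>\<^sub>M restrict_space borel U"
      using \<alpha> t0T by (auto simp: memory_strategies_def)
    from measurable_space[OF this, of "(s, \<omega>)"] show ?thesis
      using that filtration.space_F[OF filt, of T] by (simp add: space_pair_measure space_restrict_space)
  qed
  have v\<phi>_in: "v\<phi> t i \<in> V" if "t \<in> {0..T}" for t i
    using argmax[OF that, of i] by (simp add: is_arg_max_def)
  have H_le: "Hamiltonian U V Q h i t (\<phi> t) \<le> pre_Hamiltonian Q h i t (\<phi> t) u (v\<phi> t i)"
    if t: "t \<in> {0..T}" and u: "u \<in> U" for t i u
  proof -
    have "bdd_below ((\<lambda>u. pre_Hamiltonian Q h i t (\<phi> t) u (v\<phi> t i)) ` U)"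
      using BH(2)[OF t _ v\<phi>_in[OF t]] by (intro bdd_belowI2[of _ "- BH"]) (simp add: abs_le_iff minus_le_iff)
    then show ?thesis
      unfolding Hamiltonian_def Isaacs[OF t] by (rule SUP_INF_le_arg_max[OF argmax[OF t] u])
  qed
  \<comment> \<open>any single control bounds the Hamiltonian from above, hence the derivative of \<open>\<phi>\<close> from below\<close>
  obtain \<omega>0 where \<omega>0: "\<omega>0 \<in> space P"
    using not_empty by blast
  then have u0: "\<alpha> t0 \<omega>0 \<in> U"
    using \<alpha>_in t0T by auto
  have "- BH \<le> D" if "t \<in> {0..T}" "((\<lambda>s. \<phi> s i) has_real_derivative D) (at t within {0..T})" for t i D
    using Z4[OF that] H_le[OF that(1) u0, of i] BH(2)[OF that(1) u0 v\<phi>_in[OF that(1)], of i i] by linarith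
  from vector_derivative_absolutely_integrable[OF _ T_pos this] AC_\<phi>
  have der: "AE t in lebesgue. t \<in> {0..T} \<longrightarrow>
        ((\<lambda>s. \<phi> s i) has_real_derivative time_derivative T \<phi> t i) (at t within {0..T})"
    and der_int: "set_integrable lebesgue {0..T} (\<lambda>t. time_derivative T \<phi> t i)" for i
    by (simp_all add: AC_def time_derivative_def)
  have pos: "AE t in lebesgue. \<forall>i. \<forall>u\<in>U. t \<in> {0..T} \<longrightarrow>
      0 \<le> time_derivative T \<phi> t i + pre_Hamiltonian Q h i t (\<phi> t) u (v\<phi> t i)"
  proof -
    have "AE t in lebesgue. \<forall>i\<in>UNIV. t \<in> {0..T} \<longrightarrow>
        ((\<lambda>s. \<phi> s i) has_real_derivative time_derivative T \<phi> t i) (at t within {0..T})"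
      using der by (intro AE_finite_allI) auto
    then show ?thesis
    proof eventually_elim
      case (elim t)
      show ?case
      proof (intro allI ballI impI)
        fix i u assume u: "u \<in> U" and t: "t \<in> {0..T}"
        have "- Hamiltonian U V Q h i t (\<phi> t) \<le> time_derivative T \<phi> t i"
          using elim t by (intro Z4) auto
        then show "0 \<le> time_derivative T \<phi> t i + pre_Hamiltonian Q h i t (\<phi> t) u (v\<phi> t i)"
          using H_le[OF t u, of i] by linarith
      qed
    qed
  qed

  have h_meas: "(\<lambda>(s, \<omega>). ?h s \<omega>) \<in> borel_measurable (restrict_space borel {t0..T} \<Otimes>\<^sub>M P)"
    by (rule measurable_controlled_integrand[where F = "\<lambda>i t u v. h t i u v",
          OF t0 compact_controls continuous_h \<alpha> feedback setsP sub])
  have L_meas: "(\<lambda>(s, \<omega>). ?L s \<omega>) \<in> borel_measurable (restrict_space borel {t0..T} \<Otimes>\<^sub>M P)"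
    by (rule measurable_controlled_integrand[where F = "\<lambda>i t u v. \<Sum>j\<in>UNIV. Q t u v i j * \<phi> t j",
          OF t0 compact_controls cont_L \<alpha> feedback setsP sub])
  have h_bd: "\<forall>s\<in>{t0..T}. \<forall>\<omega>\<in>space P. \<bar>?h s \<omega>\<bar> \<le> Bh"
    using t0T \<alpha>_in by (intro ballI Bh v\<phi>_in) auto
  have L_bd: "\<forall>s\<in>{t0..T}. \<forall>\<omega>\<in>space P. \<bar>?L s \<omega>\<bar> \<le> BL"
    using t0T \<alpha>_in by (intro ballI BL v\<phi>_in) auto
  note h_int = running_integral[OF h_meas h_bd]
  note L_int = running_integral[OF L_meas L_bd]

  have dominate: "?X t \<omega> \<le> ?G t \<omega>" if t: "t \<in> {t0..T}" and w: "\<omega> \<in> space P" for t \<omega>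
  proof -
    have d: "set_integrable lebesgue {t0..t} (\<lambda>s. time_derivative T \<phi> s (\<omega> s))"
    proof (rule set_integrable_along_path[OF _ _ t])
      show "set_integrable lebesgue {t0..T} (\<lambda>s. time_derivative T \<phi> s i)" for i
        by (rule set_integrable_subset[OF der_int]) (use t0T in auto)
    qed (use w spaceP in simp)
    have dL: "set_integrable lebesgue {t0..t} (\<lambda>s. time_derivative T \<phi> s (\<omega> s) + ?L s \<omega>)"
      by (rule set_integral_add(1)[OF d L_int(1)[OF t w]])
    have "(LINT s:{t0..t}|lebesgue. - ?h s \<omega>) \<le>
        (LINT s:{t0..t}|lebesgue. time_derivative T \<phi> s (\<omega> s) + ?L s \<omega>)"
    proof (rule set_integral_mono_AE[OF _ dL])
      show "set_integrable lebesgue {t0..t} (\<lambda>s. - ?h s \<omega>)"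
        using set_integrable_mult_right[of "-1", OF h_int(1)[OF t w]] by simp
      show "AE s\<in>{t0..t} in lebesgue. - ?h s \<omega> \<le> time_derivative T \<phi> s (\<omega> s) + ?L s \<omega>"
        using pos
      proof eventually_elim
        case (elim s)
        show ?case
        proof
          assume s: "s \<in> {t0..t}"
          then have "\<alpha> s \<omega> \<in> U" "s \<in> {0..T}"
            using t t0T w by (auto intro: \<alpha>_in)
          then have "0 \<le> time_derivative T \<phi> s (\<omega> s) + pre_Hamiltonian Q h (\<omega> s) s (\<phi> s) (\<alpha> s \<omega>) (v\<phi> s (\<omega> s))"
            using elim by blast
          then show "- ?h s \<omega> \<le> time_derivative T \<phi> s (\<omega> s) + ?L s \<omega>"
            by (simp add: pre_Hamiltonian_def)
        qed
      qed
    qed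
    moreover have "(LINT s:{t0..t}|lebesgue. - ?h s \<omega>) = - (LINT s:{t0..t}|lebesgue. ?h s \<omega>)"
      by (simp add: set_lebesgue_integral_def)
    moreover have "\<phi> t (\<omega> t) \<le> g t (\<omega> t)"
      using t t0T by (intro Z2) auto
    ultimately show ?thesis
      by (simp add: payoff_def Dynkin_process_def feedback_to_memory_def)
  qed

  have G_meas: "?G t \<in> borel_measurable P" if t: "t \<in> {t0..T}" for t
  proof -
    have "(\<lambda>\<omega>. \<omega> t) \<in> P \<rightarrow>\<^sub>M count_space UNIV"
      unfolding measurable_cong_sets[OF setsP refl] by (rule measurable_path_value[OF t])
    then have "(\<lambda>\<omega>. g t (\<omega> t)) \<in> borel_measurable P"
      by (rule measurable_compose) simp
    then show ?thesis
      unfolding payoff_def feedback_to_memory_def using h_int(2)[OF t] by (rule borel_measurable_add)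
  qed
  have G_bd: "\<bar>?G t \<omega>\<bar> \<le> Bg + Bh * (T - t0)" if t: "t \<in> {t0..T}" and w: "\<omega> \<in> space P" for t \<omega>
    using h_int(3)[OF t w] Bg[of t "\<omega> t"] t t0T unfolding payoff_def feedback_to_memory_def by auto
  have start_value: "(LINT \<omega>|P. ?X T \<omega>) = \<phi> t0 i0"
  proof -
    have X0: "?X t0 \<omega> = \<phi> t0 (\<omega> t0)" for \<omega>
    proof -
      have "AE s in lebesgue. s \<notin> {t0}"
        by (intro AE_not_in) (simp add: negligible_iff_null_sets[symmetric])
      then have "(LINT s:{t0..t0}|lebesgue. f s) = 0" for f :: "real \<Rightarrow> real"
        unfolding set_lebesgue_integral_def by (intro integral_eq_zero_AE) (auto elim!: eventually_mono)
      then show ?thesis by (simp add: Dynkin_process_def)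
    qed
    have "(LINT \<omega>|P. ?X T \<omega>) = (LINT \<omega>|P. ?X t0 \<omega>)"
      by (rule martingale_on_stopped_finite(2)[OF prob mart t0T(1), of "\<lambda>_. t0" "{t0}", symmetric])
        (use t0T in \<open>auto intro: stopping_time_const\<close>)
    also have "\<dots> = (LINT \<omega>|P. \<phi> t0 i0)"
    proof (rule integral_cong_AE)
      show "?X t0 \<in> borel_measurable P"
        using mart t0T by (auto simp: martingale_on_def intro: borel_measurable_integrable)
      have "AE \<omega> in P. \<omega> \<in> {\<omega> \<in> space P. \<omega> t0 = i0}"
        using start by (rule AE_prob_1)
      then show "AE \<omega> in P. ?X t0 \<omega> = \<phi> t0 i0"
        by eventually_elim (simp add: X0)
    qed simp
    also have "\<dots> = \<phi> t0 i0" by (simp add: prob_space)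
    finally show ?thesis .
  qed

  have \<tau>_stop: "stopping_time ?F \<tau>"
    using \<tau> by (simp add: stopping_times_def)
  have \<tau>_in: "\<tau> \<omega> \<in> {t0..T}" if "\<omega> \<in> space P" for \<omega>
    using \<tau> that by (auto simp: stopping_times_def spaceP)
  \<comment> \<open>optional stopping is applied only to the finitely valued approximations \<open>\<sigma> n\<close> of \<open>\<tau>\<close>\<close>
  define \<sigma> where "\<sigma> n \<omega> = grid_up T n (\<tau> \<omega>)" for n \<omega>
  have \<sigma>_stop: "stopping_time ?F (\<sigma> n)" for n
    unfolding \<sigma>_def by (rule stopping_time_grid_up[OF \<tau>_stop filt])
  have \<sigma>_in: "\<sigma> n \<omega> \<in> {\<tau> \<omega>..T}" if "\<omega> \<in> space P" for n \<omega>
    using grid_up_bounds[of "\<tau> \<omega>" T n] \<tau>_in[OF that] by (simp add: \<sigma>_def)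
  define A where "A n = grid_up T n ` {t0..T}" for n
  have A: "finite (A n)" "A n \<subseteq> {t0..T}" for n
    using finite_grid_up_image grid_up_bounds(1,2)[of _ T n] by (force simp: A_def)+
  have \<sigma>_A: "\<sigma> n \<omega> \<in> A n" if "\<omega> \<in> space P" for n \<omega>
    using \<tau>_in[OF that] by (simp add: \<sigma>_def A_def)
  have \<sigma>_t: "\<sigma> n \<omega> \<in> {t0..T}" if "\<omega> \<in> space P" for n \<omega>
    using \<sigma>_A[OF that] A(2) by blast
  have G\<sigma>_meas: "(\<lambda>\<omega>. ?G (\<sigma> n \<omega>) \<omega>) \<in> borel_measurable P" for n
  proof (rule measurable_compose_countable'[of "A n" ?G _ _ "\<sigma> n"])
    show "?G t \<in> borel_measurable P" if "t \<in> A n" for t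
      using that A(2)[of n] by (intro G_meas) blast
    have [measurable]: "\<sigma> n \<in> borel_measurable P"
      by (rule measurable_stopping_time[OF \<sigma>_stop]) (use sub in \<open>auto simp: subalgebra_def\<close>)
    show "\<sigma> n \<in> P \<rightarrow>\<^sub>M count_space (A n)"
      using A(1) \<sigma>_A by (subst measurable_count_space_eq_countable) (auto intro: countable_finite)
    show "countable (A n)" using A(1) by (rule countable_finite)
  qed
  have ge: "\<phi> t0 i0 \<le> (LINT \<omega>|P. ?G (\<sigma> n \<omega>) \<omega>)" for n
  proof -
    note X\<sigma> = martingale_on_stopped_finite[OF prob mart t0T(1) \<sigma>_stop \<sigma>_A A]
    have "integrable P (\<lambda>\<omega>. ?G (\<sigma> n \<omega>) \<omega>)"
      by (rule integrable_const_bound[where B = "Bg + Bh * (T - t0)", OF _ G\<sigma>_meas])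
        (intro AE_I2, simp only: real_norm_def G_bd \<sigma>_t)
    then have "(LINT \<omega>|P. ?X (\<sigma> n \<omega>) \<omega>) \<le> (LINT \<omega>|P. ?G (\<sigma> n \<omega>) \<omega>)"
      by (intro integral_mono X\<sigma>(1) dominate \<sigma>_t)
    then show ?thesis
      using X\<sigma>(2) start_value by simp
  qed
  have lim: "(\<lambda>n. ?G (\<sigma> n \<omega>) \<omega>) \<longlonglongrightarrow> ?G (\<tau> \<omega>) \<omega>" if w: "\<omega> \<in> space P" for \<omega>
  proof -
    have \<sigma>_lim: "(\<lambda>n. \<sigma> n \<omega>) \<longlonglongrightarrow> \<tau> \<omega>"
      unfolding \<sigma>_def using \<tau>_in[OF w] by (intro grid_up_tendsto) simp
    have "(\<lambda>n. g (\<sigma> n \<omega>) (\<omega> (\<tau> \<omega>))) \<longlonglongrightarrow> g (\<tau> \<omega>) (\<omega> (\<tau> \<omega>))"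
      by (rule continuous_on_tendsto_compose[OF continuous_g \<sigma>_lim])
        (use \<tau>_in[OF w] \<sigma>_t[OF w] t0T in \<open>auto intro!: always_eventually intro: order_trans\<close>)
    moreover have "\<forall>\<^sub>F n in sequentially. g (\<sigma> n \<omega>) (\<omega> (\<tau> \<omega>)) = g (\<sigma> n \<omega>) (\<omega> (\<sigma> n \<omega>))"
      using cadlag_path_grid_up[of \<omega> t0 T "\<tau> \<omega>"] w \<tau>_in[OF w] unfolding spaceP \<sigma>_def
      by (auto elim!: eventually_mono)
    ultimately have "(\<lambda>n. g (\<sigma> n \<omega>) (\<omega> (\<sigma> n \<omega>))) \<longlonglongrightarrow> g (\<tau> \<omega>) (\<omega> (\<tau> \<omega>))"
      by (rule Lim_transform_eventually)
    then show ?thesis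
      unfolding payoff_def feedback_to_memory_def
      by (intro tendsto_add h_int(4)[OF w \<tau>_in[OF w] \<sigma>_in[OF w] \<sigma>_lim])
  qed
  have "(\<lambda>n. LINT \<omega>|P. ?G (\<sigma> n \<omega>) \<omega>) \<longlonglongrightarrow> (LINT \<omega>|P. ?G (\<tau> \<omega>) \<omega>)"
  proof (rule integral_dominated_convergence[where w = "\<lambda>_. Bg + Bh * (T - t0)"])
    show "(\<lambda>\<omega>. ?G (\<tau> \<omega>) \<omega>) \<in> borel_measurable P"
      by (rule borel_measurable_LIMSEQ_real[OF lim G\<sigma>_meas])
    show "AE \<omega> in P. (\<lambda>n. ?G (\<sigma> n \<omega>) \<omega>) \<longlonglongrightarrow> ?G (\<tau> \<omega>) \<omega>"
      by (intro AE_I2 lim)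
    show "AE \<omega> in P. norm (?G (\<sigma> n \<omega>) \<omega>) \<le> Bg + Bh * (T - t0)" for n
      by (intro AE_I2) (simp only: real_norm_def G_bd \<sigma>_t)
  qed (use G\<sigma>_meas in auto)
  then show ?thesis
    by (rule LIMSEQ_le_const) (use ge in auto)
qed

end
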